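(* Suppose that the Banach algebra $A$ is boundedly approximately amenable, and has both a multiplier-bounded left approximate identity and a multiplier-bounded right approximate identity. Then $A$ has a bounded approximate identity.
   Context: A Banach algebra $A$ is boundedly approximately amenable if for every Banach $A$-bimodule $X$ and every bounded derivation $D:A\to X^*$ (where $X^*$ has the dual bimodule structure) there is a net $(D_\alpha)$ of inner derivations $A\to X^*$, bounded in the norm of $\mathcal L(A,X^* )$, with $D_\alpha(a)\to D(a)$ in norm for all $a\in A$. A multiplier-bounded left approximate identity is a net $(f_\beta)$ in $A$ (not necessarily norm bounded) with $f_\beta a\to a$ in norm for all $a\in A$ and for which there is a constant $K$ with $\|f_\beta a\|\le K\|a\|$ for all $a\in A$ and all $\beta$. A multiplier-bounded right approximate identity is a net $(e_\alpha)$ in $A$ with $ae_\alpha\to a$ for all $a\in A$ and $\|ae_\alpha\|\le K\|a\|$ for all $a\in A$, all $\alpha$ and some constant $K$. A bounded approximate identity is a norm-bounded net $(u_\gamma)$ in $A$ with $u_\gamma a\to a$ and $au_\gamma\to a$ for all $a\in A$. *)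

theory Defs
  imports "HOL-Analysis.Analysis"
begin

section \<open>Complex Banach algebras\<close>

text \<open>Not necessarily unital. The law for one follows from \<open>scaleR_scaleC\<close>.\<close>

class complex_banach_algebra = real_normed_algebra + banach +
  fixes scaleC :: "complex \<Rightarrow> 'a \<Rightarrow> 'a"  (infixr "*\<^sub>C" 75)
  assumes scaleR_scaleC: "scaleR r x = complex_of_real r *\<^sub>C x"
    and scaleC_add_right: "c *\<^sub>C (x + y) = c *\<^sub>C x + c *\<^sub>C y"
    and scaleC_add_left: "(c + d) *\<^sub>C x = c *\<^sub>C x + d *\<^sub>C x"
    and scaleC_scaleC: "c *\<^sub>C d *\<^sub>C x = (c * d) *\<^sub>C x"
    and mult_scaleC_left: "(c *\<^sub>C x) * y = c *\<^sub>C (x * y)"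
    and mult_scaleC_right: "x * (c *\<^sub>C y) = c *\<^sub>C (x * y)"
    and norm_scaleC: "norm (c *\<^sub>C x) = cmod c * norm x"


section \<open>Banach bimodules\<close>

text \<open>
  Bimodules have explicit carriers, since amenability quantifies over them inside a formula.
  Operations are only constrained on the carrier.
\<close>

record ('a, 'x) bimod =
  carr :: "'x set"
  zer :: 'x
  add :: "'x \<Rightarrow> 'x \<Rightarrow> 'x"
  scl :: "complex \<Rightarrow> 'x \<Rightarrow> 'x"
  nrm :: "'x \<Rightarrow> real"
  lact :: "'a \<Rightarrow> 'x \<Rightarrow> 'x"
  ract :: "'x \<Rightarrow> 'a \<Rightarrow> 'x"

definition sub :: "('a, 'x) bimod \<Rightarrow> 'x \<Rightarrow> 'x \<Rightarrow> 'x" where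
  "sub X x y = add X x (scl X (-1) y)"

locale carrier_banach_space =
  fixes X :: "('a, 'x) bimod"
  assumes zer_closed: "zer X \<in> carr X"
    and add_closed: "\<lbrakk>x \<in> carr X; y \<in> carr X\<rbrakk> \<Longrightarrow> add X x y \<in> carr X"
    and scl_closed: "x \<in> carr X \<Longrightarrow> scl X c x \<in> carr X"
    and add_assoc: "\<lbrakk>x \<in> carr X; y \<in> carr X; z \<in> carr X\<rbrakk> \<Longrightarrow>
          add X (add X x y) z = add X x (add X y z)"
    and add_commute: "\<lbrakk>x \<in> carr X; y \<in> carr X\<rbrakk> \<Longrightarrow> add X x y = add X y x"
    and add_zer: "x \<in> carr X \<Longrightarrow> add X (zer X) x = x"
    and add_inverse: "x \<in> carr X \<Longrightarrow> \<exists>y\<in>carr X. add X x y = zer X"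
    and scl_add_right: "\<lbrakk>x \<in> carr X; y \<in> carr X\<rbrakk> \<Longrightarrow>
          scl X c (add X x y) = add X (scl X c x) (scl X c y)"
    and scl_add_left: "x \<in> carr X \<Longrightarrow> scl X (c + d) x = add X (scl X c x) (scl X d x)"
    and scl_scl: "x \<in> carr X \<Longrightarrow> scl X c (scl X d x) = scl X (c * d) x"
    and scl_one: "x \<in> carr X \<Longrightarrow> scl X 1 x = x"
    and nrm_nonneg: "x \<in> carr X \<Longrightarrow> 0 \<le> nrm X x"
    and nrm_eq_zero: "x \<in> carr X \<Longrightarrow> nrm X x = 0 \<longleftrightarrow> x = zer X"
    and nrm_add: "\<lbrakk>x \<in> carr X; y \<in> carr X\<rbrakk> \<Longrightarrow> nrm X (add X x y) \<le> nrm X x + nrm X y"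
    and nrm_scl: "x \<in> carr X \<Longrightarrow> nrm X (scl X c x) = cmod c * nrm X x"
    and complete: "\<lbrakk>\<And>n. s n \<in> carr X;
          \<And>e. 0 < e \<Longrightarrow> \<exists>N. \<forall>m\<ge>N. \<forall>n\<ge>N. nrm X (sub X (s m) (s n)) < e\<rbrakk> \<Longrightarrow>
          \<exists>x\<in>carr X. (\<lambda>n::nat. nrm X (sub X (s n) x)) \<longlonglongrightarrow> 0"

text \<open>The actions are bounded bilinear maps; they are not assumed to be contractive.\<close>

locale banach_bimodule = carrier_banach_space X
  for X :: "('a::complex_banach_algebra, 'x) bimod" +
  assumes lact_closed: "x \<in> carr X \<Longrightarrow> lact X a x \<in> carr X"
    and ract_closed: "x \<in> carr X \<Longrightarrow> ract X x a \<in> carr X"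
    and lact_add_right: "\<lbrakk>x \<in> carr X; y \<in> carr X\<rbrakk> \<Longrightarrow>
          lact X a (add X x y) = add X (lact X a x) (lact X a y)"
    and lact_add_left: "x \<in> carr X \<Longrightarrow> lact X (a + b) x = add X (lact X a x) (lact X b x)"
    and lact_scl_right: "x \<in> carr X \<Longrightarrow> lact X a (scl X c x) = scl X c (lact X a x)"
    and lact_scl_left: "x \<in> carr X \<Longrightarrow> lact X (c *\<^sub>C a) x = scl X c (lact X a x)"
    and ract_add_left: "\<lbrakk>x \<in> carr X; y \<in> carr X\<rbrakk> \<Longrightarrow>
          ract X (add X x y) a = add X (ract X x a) (ract X y a)"
    and ract_add_right: "x \<in> carr X \<Longrightarrow> ract X x (a + b) = add X (ract X x a) (ract X x b)"
    and ract_scl_left: "x \<in> carr X \<Longrightarrow> ract X (scl X c x) a = scl X c (ract X x a)"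
    and ract_scl_right: "x \<in> carr X \<Longrightarrow> ract X x (c *\<^sub>C a) = scl X c (ract X x a)"
    and lact_mult: "x \<in> carr X \<Longrightarrow> lact X (a * b) x = lact X a (lact X b x)"
    and ract_mult: "x \<in> carr X \<Longrightarrow> ract X x (a * b) = ract X (ract X x a) b"
    and lact_ract: "x \<in> carr X \<Longrightarrow> ract X (lact X a x) b = lact X a (ract X x b)"
    and lact_bounded: "\<exists>C. \<forall>a. \<forall>x\<in>carr X. nrm X (lact X a x) \<le> C * norm a * nrm X x"
    and ract_bounded: "\<exists>C. \<forall>a. \<forall>x\<in>carr X. nrm X (ract X x a) \<le> C * norm a * nrm X x"


section \<open>The dual bimodule\<close>

text \<open>Functionals are extensional, so that equality in the dual is equality of functions.\<close>

definition dual_carr :: "('a, 'x) bimod \<Rightarrow> ('x \<Rightarrow> complex) set" where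
  "dual_carr X = {f \<in> extensional (carr X).
     (\<forall>x\<in>carr X. \<forall>y\<in>carr X. f (add X x y) = f x + f y) \<and>
     (\<forall>c. \<forall>x\<in>carr X. f (scl X c x) = c * f x) \<and>
     (\<exists>C. \<forall>x\<in>carr X. cmod (f x) \<le> C * nrm X x)}"

definition dual_bimodule :: "('a, 'x) bimod \<Rightarrow> ('a, 'x \<Rightarrow> complex) bimod" where
  "dual_bimodule X =
    \<lparr>carr = dual_carr X,
     zer = (\<lambda>x\<in>carr X. 0),
     add = (\<lambda>f g. \<lambda>x\<in>carr X. f x + g x),
     scl = (\<lambda>c f. \<lambda>x\<in>carr X. c * f x),
     nrm = (\<lambda>f. SUP x\<in>{x\<in>carr X. nrm X x \<le> 1}. cmod (f x)),
     lact = (\<lambda>a f. \<lambda>x\<in>carr X. f (ract X x a)),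
     ract = (\<lambda>f a. \<lambda>x\<in>carr X. f (lact X a x))\<rparr>"


section \<open>Derivations and bounded approximate amenability\<close>

definition bounded_derivation ::
    "('a::complex_banach_algebra, 'y) bimod \<Rightarrow> ('a \<Rightarrow> 'y) \<Rightarrow> bool" where
  "bounded_derivation Y D \<longleftrightarrow>
     (\<forall>a. D a \<in> carr Y) \<and>
     (\<forall>a b. D (a + b) = add Y (D a) (D b)) \<and>
     (\<forall>c a. D (c *\<^sub>C a) = scl Y c (D a)) \<and>
     (\<exists>C. \<forall>a. nrm Y (D a) \<le> C * norm a) \<and>
     (\<forall>a b. D (a * b) = add Y (lact Y a (D b)) (ract Y (D a) b))"

definition inner_derivation :: "('a, 'y) bimod \<Rightarrow> ('a \<Rightarrow> 'y) \<Rightarrow> bool" where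
  "inner_derivation Y E \<longleftrightarrow> (\<exists>y\<in>carr Y. \<forall>a. E a = sub Y (lact Y a y) (ract Y y a))"

text \<open>
  Throughout, a net in a type is represented by a proper filter on that type: a net is given by
  the image of its section filter, and a property required of all members of the net is required
  eventually (conversely, a proper filter yields the net of pairs \<open>(S, s)\<close> with \<open>s \<in> S\<close> and
  \<open>S\<close> in the filter, of which one takes a tail). This avoids a choice of index sets.

  Here the norm bound says that the operator norms of the inner derivations are at most \<open>C\<close>.
\<close>

definition boundedly_approx_inner ::
    "('a::complex_banach_algebra, 'y) bimod \<Rightarrow> ('a \<Rightarrow> 'y) \<Rightarrow> bool" where
  "boundedly_approx_inner Y D \<longleftrightarrow>
     (\<exists>F :: ('a \<Rightarrow> 'y) filter. F \<noteq> bot \<and>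
        (\<forall>\<^sub>F E in F. inner_derivation Y E) \<and>
        (\<exists>C. \<forall>\<^sub>F E in F. \<forall>a. nrm Y (E a) \<le> C * norm a) \<and>
        (\<forall>a. ((\<lambda>E. nrm Y (sub Y (E a) (D a))) \<longlongrightarrow> 0) F))"

definition boundedly_approx_amenable_over ::
    "'x itself \<Rightarrow> 'a::complex_banach_algebra itself \<Rightarrow> bool" where
  "boundedly_approx_amenable_over _ _ \<longleftrightarrow>
     (\<forall>(X :: ('a, 'x) bimod) D. banach_bimodule X \<longrightarrow>
        bounded_derivation (dual_bimodule X) D \<longrightarrow> boundedly_approx_inner (dual_bimodule X) D)"

text \<open>
  HOL cannot quantify over all types, so the bimodules range over all those carried by a subset
  of the type below, with arbitrary structure. Write \<open>B\<close> for the unitization of the algebra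
  \<open>A\<close> and \<open>K\<close> for the kernel of the product map from the projective tensor product of \<open>B\<close> with
  itself to \<open>B\<close>. The type has more elements than there are functions from \<open>B \<times> B\<close> to the
  complex numbers, so it contains a copy of every Banach bimodule of at most that cardinality;
  the dual of \<open>K\<close> is one of these. The condition for the dual of \<open>K\<close> and the derivation
  \<open>a \<mapsto> a \<otimes> 1 - 1 \<otimes> a\<close> into the bidual of \<open>K\<close> already implies the condition for all Banach
  bimodules of any size, so the restriction loses nothing.
\<close>

type_synonym 'a bimod_universe = "(('a \<times> complex) \<times> ('a \<times> complex) \<Rightarrow> complex) set"

definition boundedly_approx_amenable :: "'a::complex_banach_algebra itself \<Rightarrow> bool" where
  "boundedly_approx_amenable A \<longleftrightarrow>
     boundedly_approx_amenable_over TYPE('a bimod_universe) A"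


section \<open>Approximate identities\<close>

definition has_multiplier_bounded_left_ai :: "'a::complex_banach_algebra itself \<Rightarrow> bool" where
  "has_multiplier_bounded_left_ai _ \<longleftrightarrow>
     (\<exists>F :: 'a filter. F \<noteq> bot \<and> (\<forall>a. ((\<lambda>f. f * a) \<longlongrightarrow> a) F) \<and>
        (\<exists>K. \<forall>\<^sub>F f in F. \<forall>a. norm (f * a) \<le> K * norm a))"

definition has_multiplier_bounded_right_ai :: "'a::complex_banach_algebra itself \<Rightarrow> bool" where
  "has_multiplier_bounded_right_ai _ \<longleftrightarrow>
     (\<exists>F :: 'a filter. F \<noteq> bot \<and> (\<forall>a. ((\<lambda>e. a * e) \<longlongrightarrow> a) F) \<and>
        (\<exists>K. \<forall>\<^sub>F e in F. \<forall>a. norm (a * e) \<le> K * norm a))"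

definition has_bounded_ai :: "'a::complex_banach_algebra itself \<Rightarrow> bool" where
  "has_bounded_ai _ \<longleftrightarrow>
     (\<exists>F :: 'a filter. F \<noteq> bot \<and> (\<exists>K. \<forall>\<^sub>F u in F. norm u \<le> K) \<and>
        (\<forall>a. ((\<lambda>u. u * a) \<longlongrightarrow> a) F) \<and> (\<forall>a. ((\<lambda>u. a * u) \<longlongrightarrow> a) F))"

end

theory Submission
  imports Defs
begin

text \<open>
  Approximating the derivation \<open>a \<mapsto> a \<otimes> 1 - 1 \<otimes> a\<close> with values in the bidual of
  \<open>A \<otimes> A + A \<otimes> 1 + 1 \<otimes> A\<close> by inner derivations gives, for given \<open>a\<close>, elements \<open>M\<close>, \<open>P\<close>, \<open>G\<close> of the
  biduals of \<open>A \<otimes> A\<close>, \<open>A\<close>, \<open>A\<close> with \<open>G a \<approx> a\<close>, \<open>a P \<approx> a\<close> and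
  \<open>\<parallel>w M - M w + w \<otimes> G - P \<otimes> w\<parallel> \<le> C \<parallel>w\<parallel>\<close> for all \<open>w\<close>, where \<open>C\<close> does not depend on \<open>a\<close>.
  If a multiplier-bounded left approximate identity \<open>f\<close> is not bounded, take \<open>w = f / \<parallel>f\<parallel>\<close>.
  Then \<open>\<parallel>w x\<parallel> \<le> \<theta> \<parallel>x\<parallel>\<close> with \<open>\<theta>\<close> small, so \<open>w M\<close> is negligible, and slicing with a functional \<open>\<psi>\<close> that
  norms \<open>w\<close> shows that \<open>G\<close> is within \<open>C\<close> of \<open>x w\<close> for some \<open>x\<close>. As \<open>x w a \<approx> 0\<close>, the difference is
  an approximate left unit for \<open>a\<close> of norm about \<open>C\<close>. The Hahn-Banach theorem brings it from the bidual
  down to \<open>A\<close>, and one-element approximate units \<open>r\<close> become units for a finite set when chosen with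
  \<open>r f \<approx> f\<close>. The right-hand side is the same argument in the opposite algebra.
\<close>

section \<open>The Hahn-Banach theorem\<close>

definition sublinear :: "('a::real_vector \<Rightarrow> real) \<Rightarrow> bool" where
  "sublinear q \<longleftrightarrow> (\<forall>x y. q (x + y) \<le> q x + q y) \<and> (\<forall>t x. 0 \<le> t \<longrightarrow> q (t *\<^sub>R x) = t * q x)"

lemma sublinear_lower: "sublinear q \<Longrightarrow> - q (- x) \<le> q x"
  unfolding sublinear_def
  by (metis add.right_inverse add.commute mult_zero_left neg_le_iff_le order_refl real_vector.scale_zero_left
      add_le_cancel_left add.left_inverse neg_eq_iff_add_eq_0)

lemma sublinear_zero: "sublinear q \<Longrightarrow> q 0 = 0"
  unfolding sublinear_def by (metis mult_zero_left order_refl real_vector.scale_zero_left)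

text \<open>Lowers \<open>q\<close> along \<open>a\<close>: the last property with
  \<open>x = - a\<close> and \<open>t = 1\<close> gives \<open>r (- a) \<le> - q a\<close>, so every
  linear functional below \<open>r\<close> has value at least \<open>q a\<close> at
  \<open>a\<close>. It serves twice: to fix the value at one point, and to show that minimal
  sublinear functionals are additive.\<close>

lemma sublinear_directional:
  fixes q :: "'a::real_vector \<Rightarrow> real" and a :: 'a
  assumes q: "sublinear q"
  obtains r where "sublinear r" "\<And>x. r x \<le> q x"
    "\<And>x t. 0 \<le> t \<Longrightarrow> r x \<le> q (x + t *\<^sub>R a) - t * q a"
proof -
  define r where "r = (\<lambda>x. INF t\<in>{0..}. q (x + t *\<^sub>R a) - t * q a)"
  have add: "q (x + y) \<le> q x + q y" for x y using q by (auto simp: sublinear_def)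
  have scl: "0 \<le> t \<Longrightarrow> q (t *\<^sub>R x) = t * q x" for t x using q by (auto simp: sublinear_def)
  \<comment> \<open>Subadditivity for \<open>t a = (x + t a) + (- x)\<close>. The bound does not
    depend on \<open>t\<close>, so the infimum is taken over a set bounded below.\<close>
  have low: "- q (- x) \<le> q (x + t *\<^sub>R a) - t * q a" if "t \<ge> 0" for t x
    using add[of "x + t *\<^sub>R a" "- x"] scl[OF that, of a] by simp
  have bdd: "bdd_below ((\<lambda>t. q (x + t *\<^sub>R a) - t * q a) ` {0..})" for x
    using low by (intro bdd_belowI2[of _ "- q (- x)"]) auto
  have le: "r x \<le> q (x + t *\<^sub>R a) - t * q a" if "t \<ge> 0" for t x
    unfolding r_def using that bdd by (intro cINF_lower) auto
  have rq: "r x \<le> q x" for x using le[of 0 x] by simp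
  have ge: "c \<le> r x" if "\<And>t. t \<ge> 0 \<Longrightarrow> c \<le> q (x + t *\<^sub>R a) - t * q a" for c x
    unfolding r_def using that by (intro cINF_greatest) auto
  have sub: "r (x + y) \<le> r x + r y" for x y
  proof -
    have "r (x + y) - (q (x + t *\<^sub>R a) - t * q a) \<le> r y" if "t \<ge> 0" for t
    proof (rule ge)
      fix s :: real assume "s \<ge> 0"
      then show "r (x + y) - (q (x + t *\<^sub>R a) - t * q a) \<le> q (y + s *\<^sub>R a) - s * q a"
        using le[of "t + s" "x + y"] add[of "x + t *\<^sub>R a" "y + s *\<^sub>R a"] that
        by (simp add: algebra_simps)
    qed
    then have "r (x + y) - r y \<le> r x"
      by (intro ge) (smt (verit))
    then show ?thesis by simp
  qed
  have half: "t * r x \<le> r (t *\<^sub>R x)" if "t > 0" for t x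
  proof (rule ge)
    fix s :: real assume "s \<ge> 0"
    then have "r x \<le> q (x + (s / t) *\<^sub>R a) - s / t * q a" using that by (intro le) auto
    then have "t * r x \<le> t * q (x + (s / t) *\<^sub>R a) - s * q a"
      using that by (auto simp: field_simps)
    also have "t * q (x + (s / t) *\<^sub>R a) = q (t *\<^sub>R x + s *\<^sub>R a)"
      using that scl[of t "x + (s / t) *\<^sub>R a"] by (simp add: algebra_simps)
    finally show "t * r x \<le> q (t *\<^sub>R x + s *\<^sub>R a) - s * q a" .
  qed
  have pos: "r (t *\<^sub>R x) = t * r x" if "t > 0" for t x
    using half[OF that, of x] half[of "inverse t" "t *\<^sub>R x"] that
    by (simp add: field_simps)
  have "r 0 = 0"
    using pos[of 2 0] by simp
  then have "sublinear r"
    using sub pos unfolding sublinear_def by (metis less_eq_real_def mult_zero_left real_vector.scale_zero_left)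
  then show thesis using that rq le by blast
qed

text \<open>Zorn's lemma for the reversed pointwise order. The infimum of a nonempty chain is finite
  because each member \<open>q\<close> satisfies
  \<open>- p (- x) \<le> - q (- x) \<le> q x\<close>.\<close>

lemma minimal_sublinear_exists:
  fixes p :: "'a::real_vector \<Rightarrow> real"
  assumes p: "sublinear p"
  shows "\<exists>m. sublinear m \<and> m \<le> p \<and> (\<forall>q. sublinear q \<and> q \<le> m \<longrightarrow> q = m)"
proof -
  let ?A = "{q. sublinear q \<and> q \<le> p}"
  let ?R = "relation_of (\<lambda>f g. g \<le> f) ?A"
  have "\<exists>m\<in>?A. \<forall>q\<in>?A. q \<le> m \<longrightarrow> q = m"
  proof (rule predicate_Zorn)
    show "partial_order_on ?A ?R"
      by (auto simp: partial_order_on_def preorder_on_def refl_on_def trans_def antisym_def relation_of_def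
          intro: order_trans)
    fix C assume C: "C \<in> Chains ?R"
    then have CA: "\<And>q. q \<in> C \<Longrightarrow> sublinear q \<and> q \<le> p"
      and tot: "\<And>f g. f \<in> C \<Longrightarrow> g \<in> C \<Longrightarrow> f \<le> g \<or> g \<le> f"
      by (auto simp: Chains_def relation_of_def)
    show "\<exists>u\<in>?A. \<forall>q\<in>C. u \<le> q"
    proof (cases "C = {}")
      case True
      then show ?thesis using p by auto
    next
      case False
      define u where "u = (\<lambda>x. INF q\<in>C. q x)"
      have bdd: "bdd_below ((\<lambda>q. q x) ` C)" for x
      proof (rule bdd_belowI2[of _ "- p (- x)"])
        fix q assume "q \<in> C"
        then show "- p (- x) \<le> q x"
          using CA[of q] sublinear_lower[of q x] by (auto simp: le_fun_def) (smt (verit))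
      qed
      have le: "u x \<le> q x" if "q \<in> C" for q x
        unfolding u_def using that bdd by (intro cINF_lower) auto
      have ge: "c \<le> u x" if "\<And>q. q \<in> C \<Longrightarrow> c \<le> q x" for c x
        unfolding u_def using that False by (intro cINF_greatest) auto
      have sub: "u (x + y) \<le> u x + u y" for x y
      proof -
        \<comment> \<open>Two different members of the chain occur on the right. Totality gives a
          single sublinear member below both.\<close>
        have *: "u (x + y) \<le> q1 x + q2 y" if q: "q1 \<in> C" "q2 \<in> C" for q1 q2
        proof -
          obtain q where "q \<in> C" "q \<le> q1" "q \<le> q2" using tot[OF q] q by blast
          then show ?thesis
            using le[of q "x + y"] CA[of q] unfolding sublinear_def le_fun_def by (smt (verit))
        qed
        have "u (x + y) - q1 x \<le> u y" if "q1 \<in> C" for q1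
          using * that by (intro ge) (smt (verit))
        then have "u (x + y) - u y \<le> u x"
          by (intro ge) (smt (verit))
        then show ?thesis by simp
      qed
      have scl: "u (t *\<^sub>R x) = t * u x" if "t > 0" for t x
      proof (rule antisym)
        have "u (t *\<^sub>R x) / t \<le> u x"
        proof (rule ge)
          fix q assume "q \<in> C"
          then show "u (t *\<^sub>R x) / t \<le> q x"
            using le[of q "t *\<^sub>R x"] CA[of q] that by (auto simp: sublinear_def field_simps)
        qed
        then show "u (t *\<^sub>R x) \<le> t * u x" using that by (simp add: field_simps)
        show "t * u x \<le> u (t *\<^sub>R x)"
        proof (rule ge)
          fix q assume "q \<in> C"
          then show "t * u x \<le> q (t *\<^sub>R x)"
            using le[of q x] CA[of q] that by (auto simp: sublinear_def)
        qed
      qed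
      have "u 0 = 0" using scl[of 2 0] by simp
      then have "sublinear u"
        using sub scl unfolding sublinear_def by (metis less_eq_real_def mult_zero_left real_vector.scale_zero_left)
      moreover have "u \<le> p"
      proof -
        obtain q where "q \<in> C" using False by auto
        then have "u \<le> q" "q \<le> p" using le CA by (auto simp: le_fun_def)
        then show ?thesis by (rule order_trans)
      qed
      ultimately show ?thesis using le by (auto simp: le_fun_def)
    qed
  qed
  then show ?thesis using order_trans by blast
qed

text \<open>A minimal sublinear \<open>m\<close> is linear: lowering it along \<open>b\<close>
  cannot change it, and this yields \<open>m x + m b \<le> m (x + b)\<close>. The descent starts
  from \<open>r\<close> instead of \<open>p\<close>, which forces the value \<open>p a\<close> at
  \<open>a\<close>.\<close>

lemma hahn_banach_real:
  fixes p :: "'a::real_vector \<Rightarrow> real"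
  assumes p: "sublinear p"
  obtains f where "linear f" "\<And>x. f x \<le> p x" "f a = p a"
proof -
  obtain r where r: "sublinear r" and rp: "\<And>x. r x \<le> p x"
    and ra: "\<And>x t. 0 \<le> t \<Longrightarrow> r x \<le> p (x + t *\<^sub>R a) - t * p a"
    using sublinear_directional[OF p, of a] by blast
  obtain m where M: "sublinear m \<and> m \<le> r \<and> (\<forall>q. sublinear q \<and> q \<le> m \<longrightarrow> q = m)"
    using minimal_sublinear_exists[OF r] ..
  then have m: "sublinear m" and mr: "m \<le> r" and min: "\<And>q. sublinear q \<Longrightarrow> q \<le> m \<Longrightarrow> q = m"
    by auto
  have mp: "m x \<le> p x" for x using le_funD[OF mr, of x] rp[of x] by simp
  have add: "m (x + b) = m x + m b" for x b
  proof -
    obtain s where "sublinear s" "\<And>x. s x \<le> m x"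
      and s: "\<And>x t. 0 \<le> t \<Longrightarrow> s x \<le> m (x + t *\<^sub>R b) - t * m b"
      using sublinear_directional[OF m, of b] by blast
    then have "s = m" by (intro min) (auto simp: le_fun_def)
    then have "m x \<le> m (x + b) - m b" using s[of 1 x] by simp
    moreover have "m (x + b) \<le> m x + m b" using m by (auto simp: sublinear_def)
    ultimately show ?thesis by simp
  qed
  have neg: "m (- x) = - m x" for x using add[of x "- x"] sublinear_zero[OF m] by simp
  have "m (t *\<^sub>R x) = t * m x" for t x
  proof (cases "t \<ge> 0")
    case False
    then have "m ((- t) *\<^sub>R x) = (- t) * m x" using m unfolding sublinear_def by (metis neg_0_le_iff_le nle_le)
    then show ?thesis using neg[of "t *\<^sub>R x"] by simp
  qed (use m in \<open>auto simp: sublinear_def\<close>)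
  then have "linear m" using add by (intro linearI) auto
  moreover have "m a = p a"
  proof -
    have "m (- a) \<le> p 0 - p a" using le_funD[OF mr, of "- a"] ra[of 1 "- a"] by simp
    then show ?thesis using neg[of a] mp[of a] sublinear_zero[OF p] by simp
  qed
  ultimately show thesis using that mp by blast
qed

section \<open>Functionals on a complex Banach algebra\<close>

lemma scaleC_one [simp]: "1 *\<^sub>C x = (x :: 'a::complex_banach_algebra)"
  using scaleR_scaleC[of 1 x] by simp

lemma bounded_linear_scaleC: "bounded_linear (\<lambda>x::'a::complex_banach_algebra. c *\<^sub>C x)"
proof (rule bounded_linear_intro)
  show "c *\<^sub>C (x + y) = c *\<^sub>C x + c *\<^sub>C y" for x y :: 'a by (rule scaleC_add_right)
  show "c *\<^sub>C (r *\<^sub>R x) = r *\<^sub>R (c *\<^sub>C x)" for r and x :: 'a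
    by (simp add: scaleR_scaleC scaleC_scaleC mult.commute)
  show "norm (c *\<^sub>C x) \<le> norm x * cmod c" for x :: 'a by (simp add: norm_scaleC mult.commute)
qed

definition complex_linear :: "('a::complex_banach_algebra \<Rightarrow>\<^sub>L complex) \<Rightarrow> bool" where
  "complex_linear f \<longleftrightarrow> (\<forall>c x. blinfun_apply f (c *\<^sub>C x) = c * f x)"

text \<open>A complex functional is recovered from its real part \<open>g\<close> as
  \<open>g x - \<i> * g (\<i> x)\<close>. Rotating \<open>x\<close> by a unimodular \<open>c\<close>
  makes \<open>f (c x)\<close> equal to \<open>cmod (f x)\<close>, so the bound on the real part
  bounds the modulus; and the real part of \<open>f a\<close> is already \<open>p a\<close>.\<close>

lemma hahn_banach_complex:
  fixes p :: "'a::complex_banach_algebra \<Rightarrow> real"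
  assumes add: "\<And>x y. p (x + y) \<le> p x + p y" and scl: "\<And>c x. p (c *\<^sub>C x) = cmod c * p x"
    and bound: "\<And>x. p x \<le> B * norm x"
  obtains f where "complex_linear f" "\<And>x. cmod (blinfun_apply f x) \<le> p x" "p a \<le> cmod (f a)"
proof -
  have "sublinear p"
    unfolding sublinear_def using add scl by (simp add: scaleR_scaleC)
  then obtain g where g: "linear g" and gp: "\<And>x. g x \<le> p x" and ga: "g a = p a"
    using hahn_banach_real[of p] by blast
  define f where "f = (\<lambda>x. complex_of_real (g x) - \<i> * complex_of_real (g (\<i> *\<^sub>C x)))"
  have f_add: "f (x + y) = f x + f y" for x y
    by (simp add: f_def scaleC_add_right linear_add[OF g] algebra_simps)
  have f_scaleR: "f (r *\<^sub>R x) = of_real r * f x" for r x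
  proof -
    have "\<i> *\<^sub>C (r *\<^sub>R x) = r *\<^sub>R (\<i> *\<^sub>C x)"
      by (simp add: scaleR_scaleC scaleC_scaleC mult.commute)
    then show ?thesis by (simp add: f_def linear_cmul[OF g] algebra_simps)
  qed
  have f_i: "f (\<i> *\<^sub>C x) = \<i> * f x" for x
  proof -
    have "\<i> *\<^sub>C \<i> *\<^sub>C x = (-1) *\<^sub>R x"
      by (simp add: scaleR_scaleC scaleC_scaleC)
    then show ?thesis by (simp add: f_def linear_neg[OF g] algebra_simps)
  qed
  have f_scl: "f (c *\<^sub>C x) = c * f x" for c x
  proof -
    have "c *\<^sub>C x = (of_real (Re c) + \<i> * of_real (Im c)) *\<^sub>C x"
      by (simp flip: complex_eq)
    also have "\<dots> = Re c *\<^sub>R x + \<i> *\<^sub>C (Im c *\<^sub>R x)"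
      by (simp only: scaleC_add_left scaleC_scaleC scaleR_scaleC)
    finally have "f (c *\<^sub>C x) = (of_real (Re c) + \<i> * of_real (Im c)) * f x"
      by (simp add: f_add f_i f_scaleR algebra_simps)
    then show ?thesis by (simp flip: complex_eq)
  qed
  have fp: "cmod (f x) \<le> p x" for x
  proof (cases "f x = 0")
    case True
    have "0 \<le> p x"
      using add[of x "- x"] scl[of "-1" x] scl[of 0 0] scaleR_scaleC[of "-1" x] scaleR_scaleC[of 0 "0::'a"]
      by simp
    then show ?thesis using True by simp
  next
    case False
    define c where "c = cnj (f x) / cmod (f x)"
    have c: "cmod c = 1" using False by (simp add: c_def norm_divide)
    have "f (c *\<^sub>C x) = of_real (cmod (f x))"
      using False by (simp add: f_scl c_def complex_norm_square[symmetric] power2_eq_square field_simps)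
    then have "cmod (f x) = Re (f (c *\<^sub>C x))" by simp
    also have "\<dots> = g (c *\<^sub>C x)" by (simp add: f_def)
    also have "\<dots> \<le> p x" using gp[of "c *\<^sub>C x"] scl[of c x] c by simp
    finally show ?thesis .
  qed
  have "bounded_linear f"
  proof (rule bounded_linear_intro)
    show "f (r *\<^sub>R x) = r *\<^sub>R f x" for r x by (simp add: f_scaleR scaleR_conv_of_real)
    show "norm (f x) \<le> norm x * B" for x using fp[of x] bound[of x] by (simp add: mult.commute)
  qed (rule f_add)
  then have "blinfun_apply (Blinfun f) = f" by (rule bounded_linear_Blinfun_apply)
  moreover have "p a \<le> cmod (f a)"
    using abs_Re_le_cmod[of "f a"] by (simp add: f_def ga)
  ultimately show thesis using that[of "Blinfun f"] f_scl fp by (simp add: complex_linear_def)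
qed

lemma norming_functional:
  fixes a :: "'a::complex_banach_algebra"
  obtains f where "complex_linear f" "norm f \<le> 1" "norm a \<le> cmod (blinfun_apply f a)"
proof -
  obtain f where "complex_linear f" "\<And>x. cmod (blinfun_apply f x) \<le> norm x" "norm a \<le> cmod (f a)"
    using hahn_banach_complex[of norm 1 a] by (auto simp: norm_scaleC norm_triangle_ineq)
  then show thesis by (intro that[of f] norm_blinfun_bound) auto
qed

text \<open>Separates \<open>a\<close> from the image of the \<open>B\<close>-ball under
  \<open>T\<close>, thickened by \<open>e\<close>. Used in contrapositive form, it is the descent
  from the bidual: refuting such an \<open>f\<close> produces an \<open>r\<close> in the algebra
  itself, with the same bound \<open>B\<close>.\<close>

lemma separating_functional:
  fixes a :: "'a::complex_banach_algebra" and T :: "'a \<Rightarrow>\<^sub>L 'a"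
  assumes T: "\<And>c x. T (c *\<^sub>C x) = c *\<^sub>C T x" and B: "0 < B" and e: "0 < e"
    and no: "\<And>r. norm r \<le> B \<Longrightarrow> e \<le> norm (T r - a)"
  obtains f where "complex_linear f" "norm f \<le> 1 / e" "norm (f o\<^sub>L T) \<le> 1 / B"
    "1 \<le> cmod (blinfun_apply f a)"
proof -
  \<comment> \<open>The infimal convolution of \<open>norm / e\<close> with the image of \<open>norm / B\<close> under \<open>T\<close>.\<close>
  define s where "s x r = norm r / B + norm (x - T r) / e" for x r
  define p where "p x = (INF r. s x r)" for x
  have s0: "0 \<le> s x r" for x r using B e by (simp add: s_def)
  have bdd: "bdd_below (range (s x))" for x using s0 by (intro bdd_belowI2[of _ 0]) auto
  have le: "p x \<le> s x r" for x r unfolding p_def using bdd by (intro cINF_lower) auto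
  have ge: "c \<le> p x" if "\<And>r. c \<le> s x r" for c x
    unfolding p_def using that by (intro cINF_greatest) auto
  have add: "p (x + y) \<le> p x + p y" for x y
  proof -
    have *: "p (x + y) \<le> s x r + s y r'" for r r'
    proof -
      have "norm (x + y - T (r + r')) \<le> norm (x - T r) + norm (y - T r')"
        using norm_triangle_ineq[of "x - T r" "y - T r'"]
        by (simp add: blinfun.add_right algebra_simps)
      then have "s (x + y) (r + r') \<le> s x r + s y r'"
        using norm_triangle_ineq[of r r'] B e unfolding s_def
        by (smt (verit) add_divide_distrib divide_right_mono)
      then show ?thesis using le[of "x + y" "r + r'"] by linarith
    qed
    have "p (x + y) - s x r \<le> p y" for r
      using * by (intro ge) (smt (verit))
    then have "p (x + y) - p y \<le> p x"
      by (intro ge) (smt (verit))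
    then show ?thesis by simp
  qed
  have s_scl: "s (c *\<^sub>C x) (c *\<^sub>C r) = cmod c * s x r" for c x r
  proof -
    have "c *\<^sub>C x - T (c *\<^sub>C r) = c *\<^sub>C (x - T r)"
      using T bounded_linear.linear[OF bounded_linear_scaleC[of c], THEN linear_diff] by metis
    then show ?thesis by (simp add: s_def norm_scaleC algebra_simps)
  qed
  have scl_ge: "cmod c * p x \<le> p (c *\<^sub>C x)" for c x
  proof (cases "c = 0")
    case True
    then show ?thesis by (auto intro: ge s0)
  next
    case False
    show ?thesis
    proof (rule ge)
      fix r :: 'a
      have "c *\<^sub>C (inverse c *\<^sub>C r) = r" using False by (simp add: scaleC_scaleC)
      then have "s (c *\<^sub>C x) r = cmod c * s x (inverse c *\<^sub>C r)" using s_scl by metis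
      then show "cmod c * p x \<le> s (c *\<^sub>C x) r" using le by (simp add: mult_left_mono)
    qed
  qed
  have scl: "p (c *\<^sub>C x) = cmod c * p x" for c x
  proof (cases "c = 0")
    case True
    have "p 0 \<le> 0" using le[of 0 0] by (simp add: s_def blinfun.zero_right)
    moreover have "0 *\<^sub>C x = 0" using scaleR_scaleC[of 0 x] by simp
    ultimately show ?thesis using True scl_ge[of 0 x] by simp
  next
    case False
    then have "inverse c *\<^sub>C (c *\<^sub>C x) = x" by (simp add: scaleC_scaleC)
    then have "p (c *\<^sub>C x) \<le> cmod c * p x"
      using scl_ge[of "inverse c" "c *\<^sub>C x"] False by (simp add: norm_inverse norm_divide field_simps)
    then show ?thesis using scl_ge[of c x] by simp
  qed
  have pe: "p x \<le> 1 / e * norm x" for x using le[of x 0] by (simp add: s_def blinfun.zero_right)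
  obtain f where f: "complex_linear f" and fp: "\<And>x. cmod (blinfun_apply f x) \<le> p x"
    and fa: "p a \<le> cmod (f a)"
    using hahn_banach_complex[OF add scl pe] by metis
  have "norm f \<le> 1 / e"
    using e pe fp by (intro norm_blinfun_bound) (auto intro: order_trans)
  moreover have "norm (f o\<^sub>L T) \<le> 1 / B"
  proof (rule norm_blinfun_bound)
    show "norm (blinfun_apply (f o\<^sub>L T) r) \<le> 1 / B * norm r" for r
      using fp[of "T r"] le[of "T r" r] by (simp add: s_def)
  qed (use B in simp)
  \<comment> \<open>If \<open>norm r \<le> B\<close>, the second summand of \<open>s a r\<close> is
    at least 1 by \<open>no\<close>; otherwise the first one is.\<close>
  moreover have "1 \<le> p a"
  proof (rule ge)
    fix r :: 'a show "1 \<le> s a r"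
    proof (cases "norm r \<le> B")
      case True
      then have "1 \<le> norm (a - T r) / e" using no[of r] e by (simp add: norm_minus_commute)
      then show ?thesis using B by (simp add: s_def add_increasing)
    next
      case False
      then have "1 \<le> norm r / B" using B by simp
      then show ?thesis using e by (simp add: s_def add_increasing2)
    qed
  qed
  ultimately show thesis using that f fa by force
qed

section \<open>Bounded one-sided approximate units\<close>

text \<open>The product of the algebra or of its opposite, as left and right multiplication operators.\<close>

locale product_operators =
  fixes lm rm :: "'a::complex_banach_algebra \<Rightarrow> 'a \<Rightarrow>\<^sub>L 'a"
  assumes flip: "rm y x = lm x y"
    and assoc: "lm x (lm y z) = lm (lm x y) z"
    and norm_lm: "norm (lm x y) \<le> norm x * norm y"
    and lm_scaleC: "lm x (c *\<^sub>C y) = c *\<^sub>C lm x y"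
    and rm_scaleC: "rm x (c *\<^sub>C y) = c *\<^sub>C rm x y"
begin

text \<open>
  \<open>M\<close>, \<open>P\<close>, \<open>G\<close> are the components in \<open>A \<otimes> A\<close>, \<open>A \<otimes> 1\<close>, \<open>1 \<otimes> A\<close> of an element \<open>m\<close> of the bidual,
  and the last bound is \<open>\<parallel>w m - m w\<parallel> \<le> C \<parallel>w\<parallel>\<close> tested on \<open>\<phi> \<otimes> \<eta>\<close>, which sees only \<open>A \<otimes> A\<close>.
\<close>

definition slice_bounds where
  "slice_bounds C N M P G \<longleftrightarrow> 0 \<le> N \<and>
     (\<forall>\<phi> \<eta> w. complex_linear \<phi> \<longrightarrow> complex_linear \<eta> \<longrightarrow>
        cmod (M \<phi> \<eta>) \<le> N * norm \<phi> * norm \<eta> \<and> cmod (P \<phi>) \<le> N * norm \<phi> \<and>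
        cmod (G \<eta>) \<le> N * norm \<eta> \<and>
        cmod (G \<eta> * \<phi> w + M (\<phi> o\<^sub>L lm w) \<eta> - M \<phi> (\<eta> o\<^sub>L rm w) - P \<phi> * \<eta> w)
          \<le> C * norm w * norm \<phi> * norm \<eta>)"

text \<open>The order of the quantifiers matters: \<open>C\<close> is common to all \<open>a\<close>
  and \<open>e\<close>, whereas \<open>N\<close> may vary with them. Hence in the unbounded case
  \<open>B\<close> is built from \<open>C\<close> alone, and \<open>f\<close> is chosen only after
  \<open>N\<close>.\<close>

lemma bounded_units:
  fixes F :: "'a filter"
  assumes C: "0 \<le> C"
    and diag: "\<And>a e. 0 < e \<Longrightarrow> \<exists>M P G N. slice_bounds C N M P G \<and>
       (\<forall>\<eta>. complex_linear \<eta> \<longrightarrow> cmod (G (\<eta> o\<^sub>L rm a) - \<eta> a) \<le> e * norm \<eta>)"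
    and F: "F \<noteq> bot" and lim: "\<And>a. ((\<lambda>f. lm f a) \<longlongrightarrow> a) F"
    and K: "\<forall>\<^sub>F f in F. \<forall>a. norm (lm f a) \<le> K * norm a"
  shows "\<exists>B>0. \<forall>a. \<forall>e>0. \<exists>r. norm r \<le> B \<and> norm (lm r a - a) < e"
proof (cases "\<exists>B>0. \<exists>\<^sub>F f in F. norm f \<le> B")
  case True
  then obtain B where B: "B > 0" "\<exists>\<^sub>F f in F. norm f \<le> B" by auto
  have "\<exists>r. norm r \<le> B \<and> norm (lm r a - a) < e" if "e > 0" for a e
  proof -
    have "\<forall>\<^sub>F f in F. norm (lm f a - a) < e"
      using tendstoD[OF lim that] by (simp add: dist_norm)
    then show ?thesis
      using frequently_ex[OF frequently_eventually_frequently[OF B(2)]] by auto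
  qed
  then show ?thesis using B(1) by blast
next
  case False
  then have large: "\<forall>\<^sub>F f in F. L < norm f" if "L > 0" for L
    using that by (simp add: not_frequently not_le)
  \<comment> \<open>With this \<open>B\<close> the terms \<open>C / B + 1 / B\<close> make 1/2. The
    contradiction below is between two estimates of \<open>cmod (G \<eta>)\<close>: at most 1/2 +
    1/16 + 1/16 = 5/8 from the commutator bound, and at least 1 - 1/4 = 3/4 since
    \<open>G \<eta>\<close> is close to \<open>\<gamma> a\<close>.\<close>
  define B where "B = 2 * C + 2"
  have B: "B > 0" "(C + 1) / B = 1 / 2" using C by (auto simp: B_def field_simps)
  have "\<exists>r. norm r \<le> B \<and> norm (lm r a - a) < e" if e: "e > 0" for a e
  proof (rule ccontr)
    assume "\<not> ?thesis"
    then have "\<And>r. norm r \<le> B \<Longrightarrow> e \<le> norm (rm a r - a)" by (auto simp: flip not_less)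
    then obtain \<gamma> where \<gamma>: "complex_linear \<gamma>" "norm \<gamma> \<le> 1 / e" "norm (\<gamma> o\<^sub>L rm a) \<le> 1 / B"
      "1 \<le> cmod (\<gamma> a)"
      using separating_functional[of "rm a" B e a] rm_scaleC B e by metis
    define \<eta> where "\<eta> = \<gamma> o\<^sub>L rm a"
    have \<eta>: "complex_linear \<eta>" using \<gamma>(1) rm_scaleC by (auto simp: \<eta>_def complex_linear_def)
    obtain M P G N where MPGN: "slice_bounds C N M P G"
      and GB: "\<And>\<eta>. complex_linear \<eta> \<Longrightarrow> cmod (G (\<eta> o\<^sub>L rm a) - \<eta> a) \<le> e / 4 * norm \<eta>"
      using diag[of "e / 4" a] e by auto
    have N: "0 \<le> N"
      and MB: "\<And>\<phi> \<eta>. complex_linear \<phi> \<Longrightarrow> complex_linear \<eta> \<Longrightarrow> cmod (M \<phi> \<eta>) \<le> N * norm \<phi> * norm \<eta>"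
      and PB: "\<And>\<phi>. complex_linear \<phi> \<Longrightarrow> cmod (P \<phi>) \<le> N * norm \<phi>"
      and main: "\<And>\<phi> \<eta> w. complex_linear \<phi> \<Longrightarrow> complex_linear \<eta> \<Longrightarrow>
          cmod (G \<eta> * \<phi> w + M (\<phi> o\<^sub>L lm w) \<eta> - M \<phi> (\<eta> o\<^sub>L rm w) - P \<phi> * \<eta> w)
            \<le> C * norm w * norm \<phi> * norm \<eta>"
      using MPGN unfolding slice_bounds_def by blast+
    \<comment> \<open>Chosen so that \<open>norm f > L\<close> forces
      \<open>N * \<theta> * (1 + 16 * norm a / e) \<le> 1\<close>, which makes every term carrying a
      factor \<open>\<theta>\<close> small although \<open>N\<close> is not controlled.\<close>
    define L where "L = 1 + N * \<bar>K\<bar> * (1 + 16 * norm a / e)"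
    have L: "L > 0" using N e by (simp add: L_def add_pos_nonneg)
    obtain f where f: "L < norm f" and fK: "\<And>x. norm (lm f x) \<le> K * norm x"
      using eventually_happens'[OF F eventually_conj[OF large[OF L] K]] by auto
    define \<theta> where "\<theta> = \<bar>K\<bar> / norm f"
    have \<theta>: "0 \<le> \<theta>" by (simp add: \<theta>_def)
    have "N * \<theta> * (1 + 16 * norm a / e) = (L - 1) / norm f"
      by (simp add: \<theta>_def L_def)
    also have "\<dots> \<le> 1" using f L by (simp add: divide_le_eq)
    finally have "N * \<theta> + 16 * (N * \<theta> * (norm a / e)) \<le> 1" by (simp add: algebra_simps)
    moreover have "0 \<le> N * \<theta>" "0 \<le> N * \<theta> * (norm a / e)" using N \<theta> e by auto
    ultimately have "N * \<theta> \<le> 1" "N * \<theta> * (norm a / e) \<le> 1 / 16"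
      by linarith+
    then have small: "N * \<theta> \<le> 1" "N * \<theta> * norm a / e \<le> 1 / 16"
      by simp_all
    \<comment> \<open>Left multiplication by the unit vector \<open>w\<close> has norm at most \<open>\<theta>\<close>, so only \<open>G \<eta> * \<psi> w\<close> survives.\<close>
    define w where "w = f /\<^sub>R norm f"
    have "norm f \<noteq> 0" using f L by linarith
    then have w1: "norm w = 1" by (simp add: w_def)
    have lw: "norm (lm w x) \<le> \<theta> * norm x" for x
    proof -
      have "norm (lm w x) = norm (lm f x) / norm f"
        by (simp add: w_def blinfun.scaleR_right divide_inverse_commute flip: flip)
      also have "\<dots> \<le> (\<bar>K\<bar> * norm x) / norm f"
        using order_trans[OF fK mult_right_mono[OF abs_ge_self]] by (intro divide_right_mono) auto
      finally show ?thesis by (simp add: \<theta>_def)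
    qed
    obtain \<psi> where \<psi>: "complex_linear \<psi>" "norm \<psi> \<le> 1" "1 \<le> cmod (\<psi> w)"
      using norming_functional[of w] w1 by auto
    \<comment> \<open>By associativity \<open>(y w) a = y (w a)\<close>, so
      \<open>\<eta> o\<^sub>L rm w\<close> only sees the small element \<open>w a\<close>.\<close>
    have \<gamma>wa: "cmod (\<gamma> (lm y (lm w a))) \<le> \<theta> * norm a / e * norm y" for y
    proof -
      have "cmod (\<gamma> (lm y (lm w a))) \<le> norm \<gamma> * norm (lm y (lm w a))" by (rule norm_blinfun)
      also have "\<dots> \<le> 1 / e * (norm y * (\<theta> * norm a))"
        using \<gamma>(2) e norm_lm[of y "lm w a"] mult_left_mono[OF lw[of a], of "norm y"]
        by (intro mult_mono) auto
      finally show ?thesis by (simp add: mult.commute mult.left_commute)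
    qed
    have "norm (\<eta> o\<^sub>L rm w) \<le> \<theta> * norm a / e"
      using \<gamma>wa e \<theta> by (intro norm_blinfun_bound) (auto simp: \<eta>_def flip assoc)
    moreover have "complex_linear (\<eta> o\<^sub>L rm w)"
      using \<eta> rm_scaleC by (auto simp: complex_linear_def)
    ultimately have m2: "cmod (M \<psi> (\<eta> o\<^sub>L rm w)) \<le> N * 1 * (\<theta> * norm a / e)"
      using \<psi> N by (intro order_trans[OF MB] mult_mono) auto
    have "norm (\<psi> o\<^sub>L lm w) \<le> \<theta>"
    proof (rule norm_blinfun_bound[OF \<theta>])
      fix x
      have "cmod (\<psi> (lm w x)) \<le> norm \<psi> * norm (lm w x)" by (rule norm_blinfun)
      also have "\<dots> \<le> 1 * (\<theta> * norm x)" using \<psi>(2) lw by (intro mult_mono) auto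
      finally show "cmod ((\<psi> o\<^sub>L lm w) x) \<le> \<theta> * norm x" by simp
    qed
    moreover have "complex_linear (\<psi> o\<^sub>L lm w)"
      using \<psi>(1) lm_scaleC by (auto simp: complex_linear_def)
    ultimately have m1: "cmod (M (\<psi> o\<^sub>L lm w) \<eta>) \<le> N * \<theta> * (1 / B)"
      using \<eta> \<gamma>(3) N \<theta> by (intro order_trans[OF MB] mult_mono) (auto simp: \<eta>_def)
    have "cmod (\<eta> w) \<le> norm \<gamma> * norm (lm w a)"
      using norm_blinfun[of \<gamma> "lm w a"] by (simp add: \<eta>_def flip)
    also have "\<dots> \<le> 1 / e * (\<theta> * norm a)" using \<gamma>(2) lw e by (intro mult_mono) auto
    finally have "cmod (\<eta> w) \<le> 1 / e * (\<theta> * norm a)" .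
    moreover have "cmod (P \<psi>) \<le> N * 1"
      using order_trans[OF PB[OF \<psi>(1)] mult_left_mono[OF \<psi>(2) N]] .
    ultimately have "cmod (P \<psi>) * cmod (\<eta> w) \<le> (N * 1) * (1 / e * (\<theta> * norm a))"
      using N by (intro mult_mono) auto
    then have m3: "cmod (P \<psi> * \<eta> w) \<le> N * \<theta> * norm a / e" by (simp add: norm_mult mult.assoc)
    have "C * norm w * norm \<psi> * norm \<eta> \<le> C * 1 * 1 * (1 / B)"
      using \<psi>(2) \<gamma>(3) C w1 by (intro mult_mono) (auto simp: \<eta>_def)
    then have m0: "cmod (G \<eta> * \<psi> w + M (\<psi> o\<^sub>L lm w) \<eta> - M \<psi> (\<eta> o\<^sub>L rm w) - P \<psi> * \<eta> w) \<le> C / B"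
      using main[OF \<psi>(1) \<eta>, of w] by simp
    have "cmod (G \<eta> * \<psi> w) \<le> C / B + cmod (M (\<psi> o\<^sub>L lm w) \<eta>)
        + cmod (M \<psi> (\<eta> o\<^sub>L rm w)) + cmod (P \<psi> * \<eta> w)"
      using m0
        norm_triangle_ineq4[of "G \<eta> * \<psi> w + M (\<psi> o\<^sub>L lm w) \<eta> - M \<psi> (\<eta> o\<^sub>L rm w) - P \<psi> * \<eta> w"
          "M (\<psi> o\<^sub>L lm w) \<eta> - M \<psi> (\<eta> o\<^sub>L rm w) - P \<psi> * \<eta> w"]
        norm_triangle_ineq4[of "M (\<psi> o\<^sub>L lm w) \<eta> - M \<psi> (\<eta> o\<^sub>L rm w)" "P \<psi> * \<eta> w"]
        norm_triangle_ineq4[of "M (\<psi> o\<^sub>L lm w) \<eta>" "M \<psi> (\<eta> o\<^sub>L rm w)"]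
      by (simp add: algebra_simps)
    also have "\<dots> \<le> C / B + 1 / B + 1 / 16 + 1 / 16"
    proof -
      have "N * \<theta> * (1 / B) \<le> 1 / B" using small(1) B(1) by (simp add: divide_right_mono)
      moreover have "cmod (M \<psi> (\<eta> o\<^sub>L rm w)) \<le> N * \<theta> * norm a / e"
        using m2 by (simp add: mult.assoc)
      ultimately show ?thesis using m1 m3 small(2) by linarith
    qed
    also have "\<dots> = 5 / 8" using B(2) unfolding add_divide_distrib by linarith
    finally have "cmod (G \<eta>) * cmod (\<psi> w) \<le> 5 / 8" by (simp add: norm_mult)
    moreover have "cmod (G \<eta>) * 1 \<le> cmod (G \<eta>) * cmod (\<psi> w)"
      using \<psi>(3) by (intro mult_left_mono) auto
    moreover have "e / 4 * norm \<gamma> \<le> 1 / 4" using \<gamma>(2) e by (simp add: field_simps)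
    then have "cmod (G \<eta>) \<ge> 3 / 4"
      using GB[OF \<gamma>(1)] \<gamma>(4) norm_triangle_ineq2[of "\<gamma> a" "G \<eta>"]
      by (simp add: \<eta>_def norm_minus_commute)
    ultimately show False by simp
  qed
  then show ?thesis using B(1) by blast
qed

lemma bounded_approximate_units:
  fixes F :: "'a filter"
  assumes B: "0 < B" and units: "\<And>a e. 0 < e \<Longrightarrow> \<exists>r. norm r \<le> B \<and> norm (lm r a - a) < e"
    and F: "F \<noteq> bot" and lim: "\<And>a. ((\<lambda>f. lm f a) \<longlongrightarrow> a) F"
    and S: "finite S" and e: "0 < e"
  shows "\<exists>r. norm r \<le> B \<and> (\<forall>a\<in>S. norm (lm r a - a) < e)"
proof -
  define m where "m = (\<Sum>a\<in>S. norm a)"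
  \<comment> \<open>The three summands of the decomposition \<open>eq\<close> below cost
    \<open>d * m\<close>, \<open>B * d\<close> and \<open>d\<close>, and these add up to
    \<open>e\<close>. The unit \<open>r\<close> is required for the single element \<open>f\<close>
    only.\<close>
  define d where "d = e / (B + 1 + m)"
  have m: "0 \<le> m" "norm a \<le> m" if "a \<in> S" for a
    unfolding m_def using S that by (auto intro: sum_nonneg member_le_sum)
  have m0: "0 \<le> m" by (simp add: m_def sum_nonneg)
  then have d: "0 < d" using B e by (simp add: d_def)
  have "d * (B + 1 + m) = e" using B m0 by (simp add: d_def)
  then have de: "B * d + d * m + d = e" by (simp add: algebra_simps)
  have "\<forall>\<^sub>F f in F. \<forall>a\<in>S. norm (lm f a - a) < d"
    using S tendstoD[OF lim d] by (simp add: eventually_ball_finite_distrib dist_norm)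
  then obtain f where f: "\<And>a. a \<in> S \<Longrightarrow> norm (lm f a - a) < d"
    using eventually_happens'[OF F] by blast
  obtain r where r: "norm r \<le> B" "norm (lm r f - f) < d" using units[OF d] by blast
  have "norm (lm r a - a) < e" if a: "a \<in> S" for a
  proof -
    have eq: "lm r a - a = lm (lm r f - f) a - lm r (lm f a - a) + (lm f a - a)"
      by (simp add: assoc blinfun.diff_right blinfun.diff_left flip: flip)
         (simp add: flip assoc)
    have "norm (lm r a - a) \<le> norm (lm (lm r f - f) a) + norm (lm r (lm f a - a)) + norm (lm f a - a)"
      unfolding eq using norm_triangle_ineq[of "lm (lm r f - f) a - lm r (lm f a - a)" "lm f a - a"]
        norm_triangle_ineq4[of "lm (lm r f - f) a" "lm r (lm f a - a)"] by linarith
    also have "norm (lm (lm r f - f) a) \<le> d * m"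
      using r(2) m(2)[OF a] m0 d by (intro order_trans[OF norm_lm] mult_mono) auto
    also have "norm (lm r (lm f a - a)) \<le> B * d"
      using r(1) f[OF a] B by (intro order_trans[OF norm_lm] mult_mono) auto
    finally show ?thesis using f[OF a] de by linarith
  qed
  then show ?thesis using r(1) by blast
qed

end

section \<open>Bimodules and their duals\<close>

context carrier_banach_space
begin

lemma dual_zer: "m \<in> dual_carr X \<Longrightarrow> m (zer X) = 0"
  using zer_closed add_zer[OF zer_closed] by (auto simp: dual_carr_def) (metis add_cancel_right_right)

lemma dual_bound:
  assumes "m \<in> dual_carr X"
  obtains C where "0 \<le> C" "\<And>x. x \<in> carr X \<Longrightarrow> cmod (m x) \<le> C * nrm X x"
proof -
  obtain C where C: "\<forall>x\<in>carr X. cmod (m x) \<le> C * nrm X x"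
    using assms unfolding dual_carr_def by blast
  have "cmod (m x) \<le> \<bar>C\<bar> * nrm X x" if "x \<in> carr X" for x
    using C that nrm_nonneg[OF that] by (meson abs_ge_self mult_right_mono order_trans)
  then show thesis using that[of "\<bar>C\<bar>"] by simp
qed

text \<open>A real supremum is an upper bound only when the set is bounded above, so this is needed
  before the dual norm can be used at all.\<close>

lemma dual_nrm_bdd:
  assumes "m \<in> dual_carr X"
  shows "bdd_above ((\<lambda>x. cmod (m x)) ` {x \<in> carr X. nrm X x \<le> 1})"
proof -
  obtain C where "0 \<le> C" "\<And>x. x \<in> carr X \<Longrightarrow> cmod (m x) \<le> C * nrm X x"
    using dual_bound[OF assms] by blast
  then have "cmod (m x) \<le> C" if "x \<in> carr X" "nrm X x \<le> 1" for x
    using that by (meson mult_left_le order_trans)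
  then show ?thesis by (intro bdd_aboveI2[where M = C]) auto
qed

lemma dual_nrm_apply:
  assumes m: "m \<in> dual_carr X" and x: "x \<in> carr X"
  shows "cmod (m x) \<le> nrm (dual_bimodule X) m * nrm X x"
proof (cases "nrm X x = 0")
  case True
  then show ?thesis using x nrm_eq_zero[OF x] dual_zer[OF m] by simp
next
  case False
  then have pos: "nrm X x > 0" using nrm_nonneg[OF x] by simp
  let ?y = "scl X (complex_of_real (inverse (nrm X x))) x"
  have y: "?y \<in> carr X" "nrm X ?y \<le> 1"
    using x pos by (auto simp: scl_closed nrm_scl norm_inverse)
  have "cmod (m ?y) \<le> nrm (dual_bimodule X) m"
    using cSUP_upper[OF _ dual_nrm_bdd[OF m], of ?y] y by (simp add: dual_bimodule_def)
  moreover have "m ?y = complex_of_real (inverse (nrm X x)) * m x"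
    using m x unfolding dual_carr_def by blast
  then have "cmod (m ?y) = inverse (nrm X x) * cmod (m x)"
    using pos by (simp only: norm_mult norm_of_real abs_inverse abs_of_pos)
  ultimately have "inverse (nrm X x) * cmod (m x) \<le> nrm (dual_bimodule X) m" by metis
  then show ?thesis using pos by (simp add: field_simps)
qed

lemma dual_nrm_le:
  assumes C: "0 \<le> C" and m: "\<And>x. x \<in> carr X \<Longrightarrow> cmod (m x) \<le> C * nrm X x"
  shows "nrm (dual_bimodule X) m \<le> C"
proof -
  have "zer X \<in> {x \<in> carr X. nrm X x \<le> 1}"
    using zer_closed nrm_eq_zero[OF zer_closed] by simp
  then have "(SUP x\<in>{x \<in> carr X. nrm X x \<le> 1}. cmod (m x)) \<le> C"
  proof (intro cSUP_least)
    fix x assume x: "x \<in> {x \<in> carr X. nrm X x \<le> 1}"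
    then have "cmod (m x) \<le> C * nrm X x" using m by auto
    also have "\<dots> \<le> C * 1" using x C by (intro mult_left_mono) auto
    finally show "cmod (m x) \<le> C" by simp
  qed auto
  then show ?thesis by (simp add: dual_bimodule_def)
qed

lemma dual_sub_closed:
  assumes "m \<in> dual_carr X" "n \<in> dual_carr X"
  shows "sub (dual_bimodule X) m n \<in> dual_carr X"
proof -
  obtain C where C: "0 \<le> C" "\<And>x. x \<in> carr X \<Longrightarrow> cmod (m x) \<le> C * nrm X x"
    using dual_bound[OF assms(1)] by blast
  obtain D where D: "0 \<le> D" "\<And>x. x \<in> carr X \<Longrightarrow> cmod (n x) \<le> D * nrm X x"
    using dual_bound[OF assms(2)] by blast
  have "\<forall>x\<in>carr X. cmod (m x - n x) \<le> (C + D) * nrm X x"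
  proof
    fix x assume x: "x \<in> carr X"
    show "cmod (m x - n x) \<le> (C + D) * nrm X x"
      using C(2)[OF x] D(2)[OF x] norm_triangle_ineq4[of "m x" "n x"] by (simp add: algebra_simps)
  qed
  then have "\<exists>C. \<forall>x\<in>carr X. cmod (m x - n x) \<le> C * nrm X x" by blast
  then show ?thesis
    using assms
    by (auto simp: dual_carr_def sub_def dual_bimodule_def add_closed scl_closed algebra_simps)
qed

end

lemma sub_dual_apply:
  "x \<in> carr X \<Longrightarrow> sub (dual_bimodule X) m n x = m x - n x"
  by (simp add: sub_def dual_bimodule_def)

lemma (in banach_bimodule) dual_lact_closed:
  assumes "m \<in> dual_carr X"
  shows "lact (dual_bimodule X) a m \<in> dual_carr X"
proof -
  obtain C where C: "0 \<le> C" "\<And>x. x \<in> carr X \<Longrightarrow> cmod (m x) \<le> C * nrm X x"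
    using dual_bound[OF assms] by blast
  obtain R where R: "\<forall>a. \<forall>x\<in>carr X. nrm X (ract X x a) \<le> R * norm a * nrm X x"
    using ract_bounded by blast
  have "cmod (m (ract X x a)) \<le> (C * R * norm a) * nrm X x" if "x \<in> carr X" for x
  proof -
    have "cmod (m (ract X x a)) \<le> C * nrm X (ract X x a)"
      using C(2)[OF ract_closed[OF that]] .
    also have "\<dots> \<le> C * (R * norm a * nrm X x)"
      using R that C(1) by (intro mult_left_mono) auto
    finally show ?thesis by (simp add: mult.assoc)
  qed
  then show ?thesis
    using assms
    by (auto simp: dual_carr_def dual_bimodule_def ract_closed add_closed scl_closed
        ract_add_left ract_scl_left)
qed

lemma (in banach_bimodule) dual_ract_closed:
  assumes "m \<in> dual_carr X"
  shows "ract (dual_bimodule X) m a \<in> dual_carr X"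
proof -
  obtain C where C: "0 \<le> C" "\<And>x. x \<in> carr X \<Longrightarrow> cmod (m x) \<le> C * nrm X x"
    using dual_bound[OF assms] by blast
  obtain L where L: "\<forall>a. \<forall>x\<in>carr X. nrm X (lact X a x) \<le> L * norm a * nrm X x"
    using lact_bounded by blast
  have "cmod (m (lact X a x)) \<le> (C * L * norm a) * nrm X x" if "x \<in> carr X" for x
  proof -
    have "cmod (m (lact X a x)) \<le> C * nrm X (lact X a x)"
      using C(2)[OF lact_closed[OF that]] .
    also have "\<dots> \<le> C * (L * norm a * nrm X x)"
      using L that C(1) by (intro mult_left_mono) auto
    finally show ?thesis by (simp add: mult.assoc)
  qed
  then show ?thesis
    using assms
    by (auto simp: dual_carr_def dual_bimodule_def lact_closed add_closed scl_closed
        lact_add_right lact_scl_right)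
qed

text \<open>One member \<open>E\<close> of the net, implemented by \<open>m\<close>, is kept: the
  uniform bound applies to all \<open>b\<close>, the closeness only to the given \<open>a\<close>.
  That \<open>C\<close> comes before \<open>a\<close> and \<open>e\<close> is the boundedness of the
  net.\<close>

lemma (in banach_bimodule) boundedly_approx_inner_dualD:
  assumes inner: "boundedly_approx_inner (dual_bimodule X) D" and D: "\<And>a. D a \<in> dual_carr X"
  obtains C where "0 \<le> C"
    "\<And>a e. 0 < e \<Longrightarrow> \<exists>m\<in>dual_carr X.
      (\<forall>b. \<forall>x\<in>carr X. cmod (m (ract X x b) - m (lact X b x)) \<le> C * norm b * nrm X x) \<and>
      (\<forall>x\<in>carr X. cmod (m (ract X x a) - m (lact X a x) - D a x) \<le> e * nrm X x)"
proof -
  let ?Y = "dual_bimodule X"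
  obtain F C where F: "F \<noteq> bot" and inn: "\<forall>\<^sub>F E in F. inner_derivation ?Y E"
    and C: "\<forall>\<^sub>F E in F. \<forall>a. nrm ?Y (E a) \<le> C * norm a"
    and lim: "\<And>a. ((\<lambda>E. nrm ?Y (sub ?Y (E a) (D a))) \<longlongrightarrow> 0) F"
    using inner unfolding boundedly_approx_inner_def by auto
  have "\<exists>m\<in>dual_carr X.
      (\<forall>b. \<forall>x\<in>carr X. cmod (m (ract X x b) - m (lact X b x)) \<le> \<bar>C\<bar> * norm b * nrm X x) \<and>
      (\<forall>x\<in>carr X. cmod (m (ract X x a) - m (lact X a x) - D a x) \<le> e * nrm X x)"
    if e: "0 < e" for a e
  proof -
    have "\<forall>\<^sub>F E in F. nrm ?Y (sub ?Y (E a) (D a)) < e"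
      using order_tendstoD(2)[OF lim e] .
    then obtain E where E: "inner_derivation ?Y E" "\<And>a. nrm ?Y (E a) \<le> C * norm a"
      "nrm ?Y (sub ?Y (E a) (D a)) < e"
      using eventually_happens'[OF F eventually_conj[OF inn eventually_conj[OF C]]] by blast
    obtain m where "m \<in> carr ?Y" and Em: "\<And>a. E a = sub ?Y (lact ?Y a m) (ract ?Y m a)"
      using E(1) unfolding inner_derivation_def by auto
    then have m: "m \<in> dual_carr X" by (simp add: dual_bimodule_def)
    have Ed: "E b \<in> dual_carr X" for b
      unfolding Em using m by (intro dual_sub_closed dual_lact_closed dual_ract_closed)
    have Ex: "E b x = m (ract X x b) - m (lact X b x)" if "x \<in> carr X" for b x
      using that unfolding Em by (simp add: sub_dual_apply) (simp add: dual_bimodule_def)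
    have "cmod (m (ract X x b) - m (lact X b x)) \<le> \<bar>C\<bar> * norm b * nrm X x" if x: "x \<in> carr X" for b x
    proof -
      have "cmod (E b x) \<le> nrm ?Y (E b) * nrm X x" by (rule dual_nrm_apply[OF Ed x])
      also have "\<dots> \<le> \<bar>C\<bar> * norm b * nrm X x"
        using E(2)[of b] nrm_nonneg[OF x]
        by (meson abs_ge_self mult_right_mono norm_ge_zero order_trans)
      finally show ?thesis by (simp add: Ex x)
    qed
    moreover have "cmod (m (ract X x a) - m (lact X a x) - D a x) \<le> e * nrm X x" if x: "x \<in> carr X" for x
    proof -
      have "cmod (sub ?Y (E a) (D a) x) \<le> nrm ?Y (sub ?Y (E a) (D a)) * nrm X x"
        by (rule dual_nrm_apply[OF dual_sub_closed[OF Ed D] x])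
      also have "\<dots> \<le> e * nrm X x"
        using E(3) nrm_nonneg[OF x] by (intro mult_right_mono) auto
      finally show ?thesis by (simp add: sub_dual_apply Ex x)
    qed
    ultimately show ?thesis using m by blast
  qed
  then show thesis using that[of "\<bar>C\<bar>"] by simp
qed

section \<open>Moving a bimodule structure along an injection\<close>

definition transport :: "('x \<Rightarrow> 'y) \<Rightarrow> ('a, 'x) bimod \<Rightarrow> ('a, 'y) bimod" where
  "transport i X =
    \<lparr>carr = i ` carr X,
     zer = i (zer X),
     add = (\<lambda>u v. i (add X (inv i u) (inv i v))),
     scl = (\<lambda>c u. i (scl X c (inv i u))),
     nrm = (\<lambda>u. nrm X (inv i u)),
     lact = (\<lambda>a u. i (lact X a (inv i u))),
     ract = (\<lambda>u a. i (ract X (inv i u) a))\<rparr>"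

lemma transport_sel:
  assumes "inj i"
  shows "carr (transport i X) = i ` carr X" "zer (transport i X) = i (zer X)"
    "add (transport i X) (i x) (i y) = i (add X x y)" "scl (transport i X) c (i x) = i (scl X c x)"
    "nrm (transport i X) (i x) = nrm X x" "lact (transport i X) a (i x) = i (lact X a x)"
    "ract (transport i X) (i x) a = i (ract X x a)" "sub (transport i X) (i x) (i y) = i (sub X x y)"
  using assms by (simp_all add: transport_def sub_def)

text \<open>Amenability speaks only of bimodules in one fixed type, so a bimodule living elsewhere
  enters through an injective copy. The operations on the image are conjugate to the original ones,
  hence each axiom carries over.\<close>

lemma banach_bimodule_transport:
  assumes i: "inj i" and X: "banach_bimodule X"
  shows "banach_bimodule (transport i X)"
proof -
  interpret banach_bimodule X by (rule X)
  note ts = transport_sel[OF i] inj_eq[OF i]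
  have cs: "carrier_banach_space (transport i X)"
  proof
    fix s :: "nat \<Rightarrow> 'b"
    assume s: "\<And>n. s n \<in> carr (transport i X)"
      and cauchy: "\<And>e. 0 < e \<Longrightarrow> \<exists>N. \<forall>m\<ge>N. \<forall>n\<ge>N. nrm (transport i X) (sub (transport i X) (s m) (s n)) < e"
    have "\<forall>n. \<exists>x. x \<in> carr X \<and> s n = i x" using s by (auto simp: ts)
    then obtain t where t: "\<And>n. t n \<in> carr X" "\<And>n. s n = i (t n)" by metis
    have "\<exists>x\<in>carr X. (\<lambda>n. nrm X (sub X (t n) x)) \<longlonglongrightarrow> 0"
      by (rule complete) (use cauchy in \<open>simp_all add: t ts\<close>)
    then show "\<exists>x\<in>carr (transport i X). (\<lambda>n. nrm (transport i X) (sub (transport i X) (s n) x)) \<longlonglongrightarrow> 0"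
      by (auto simp: ts t)
  qed (auto simp: ts zer_closed add_closed scl_closed add_assoc add_zer add_inverse
      scl_add_right scl_add_left scl_scl scl_one nrm_nonneg nrm_eq_zero nrm_add nrm_scl
      intro: add_commute)
  interpret T: carrier_banach_space "transport i X" by (rule cs)
  obtain L R where "\<forall>a. \<forall>x\<in>carr X. nrm X (lact X a x) \<le> L * norm a * nrm X x"
    "\<forall>a. \<forall>x\<in>carr X. nrm X (ract X x a) \<le> R * norm a * nrm X x"
    using lact_bounded ract_bounded by blast
  then have "\<exists>C. \<forall>a. \<forall>x\<in>carr (transport i X).
      nrm (transport i X) (lact (transport i X) a x) \<le> C * norm a * nrm (transport i X) x"
    "\<exists>C. \<forall>a. \<forall>x\<in>carr (transport i X).
      nrm (transport i X) (ract (transport i X) x a) \<le> C * norm a * nrm (transport i X) x"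
    by (auto simp: ts)
  then show ?thesis
    by unfold_locales (auto simp: ts lact_closed ract_closed lact_add_right lact_add_left
      lact_scl_right lact_scl_left ract_add_left ract_add_right ract_scl_left ract_scl_right
      lact_mult ract_mult lact_ract)
qed

section \<open>The universal derivation\<close>

text \<open>Bounded linear maps come with real scalars only; the complex scalar acts by multiplying
  the values.\<close>

definition scale1 :: "complex \<Rightarrow> ('a::real_normed_vector \<Rightarrow>\<^sub>L complex) \<Rightarrow> 'a \<Rightarrow>\<^sub>L complex" where
  "scale1 c f = blinfun_mult_right c o\<^sub>L f"

definition post ::
    "('b::real_normed_vector \<Rightarrow>\<^sub>L 'c::real_normed_vector) \<Rightarrow> ('a::real_normed_vector \<Rightarrow>\<^sub>L 'b) \<Rightarrow>\<^sub>L ('a \<Rightarrow>\<^sub>L 'c)" where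
  "post S = Blinfun (\<lambda>f. S o\<^sub>L f)"

definition pre ::
    "('a::real_normed_vector \<Rightarrow>\<^sub>L 'b::real_normed_vector) \<Rightarrow> ('b \<Rightarrow>\<^sub>L 'c::real_normed_vector) \<Rightarrow>\<^sub>L ('a \<Rightarrow>\<^sub>L 'c)" where
  "pre R = Blinfun (\<lambda>f. f o\<^sub>L R)"

definition eval_at :: "'a::real_normed_vector \<Rightarrow> ('a \<Rightarrow>\<^sub>L 'b::real_normed_vector) \<Rightarrow>\<^sub>L 'b" where
  "eval_at a = Blinfun (\<lambda>f. blinfun_apply f a)"

text \<open>The curried bilinear form \<open>(x, y) \<mapsto> f x * g y\<close>, that is
  \<open>f \<otimes> g\<close> as a functional on the projective tensor product.\<close>

definition tensor ::
    "('a::real_normed_vector \<Rightarrow>\<^sub>L complex) \<Rightarrow> ('a \<Rightarrow>\<^sub>L complex) \<Rightarrow> 'a \<Rightarrow>\<^sub>L 'a \<Rightarrow>\<^sub>L complex" where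
  "tensor f g = Blinfun (\<lambda>c. scale1 c g) o\<^sub>L f"

lemma post_apply [simp]: "post S f = S o\<^sub>L f"
  unfolding post_def
  by (subst bounded_linear_Blinfun_apply)
    (auto intro: bounded_bilinear.bounded_linear_right[OF bounded_bilinear_blinfun_compose])

lemma pre_apply [simp]: "pre R f = f o\<^sub>L R"
  unfolding pre_def
  by (subst bounded_linear_Blinfun_apply)
    (auto intro: bounded_bilinear.bounded_linear_left[OF bounded_bilinear_blinfun_compose])

lemma eval_at_apply [simp]: "eval_at a f = f a"
  unfolding eval_at_def by (subst bounded_linear_Blinfun_apply) auto

lemma scale1_apply [simp]: "scale1 c f x = c * f x"
  by (simp add: scale1_def blinfun_mult_right.rep_eq)

lemma tensor_apply [simp]: "tensor f g x = scale1 (f x) g"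
proof -
  have "bounded_linear (\<lambda>c. scale1 c g)"
    unfolding scale1_def
    by (intro bounded_linear_compose[OF _ bounded_linear_blinfun_mult_right, unfolded o_def]
        bounded_bilinear.bounded_linear_left[OF bounded_bilinear_blinfun_compose])
  then show ?thesis by (simp add: tensor_def bounded_linear_Blinfun_apply)
qed

lemma norm_scale1_le: "norm (scale1 c f) \<le> cmod c * norm f"
proof (rule norm_blinfun_bound)
  show "norm (scale1 c f x) \<le> cmod c * norm f * norm x" for x
    using norm_blinfun[of f x] by (simp add: norm_mult mult.assoc mult_left_mono)
qed simp

lemma norm_tensor: "norm (tensor f g) \<le> norm f * norm g"
proof (rule norm_blinfun_bound)
  show "norm (tensor f g x) \<le> norm f * norm g * norm x" for x
    using norm_scale1_le[of "f x" g] mult_right_mono[OF norm_blinfun[of f x], of "norm g"]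
    by (simp add: mult.commute mult.left_commute)
qed simp

section \<open>The bimodule of triples\<close>

type_synonym 'a triple =
  "('a \<Rightarrow>\<^sub>L 'a \<Rightarrow>\<^sub>L complex) \<times> ('a \<Rightarrow>\<^sub>L complex) \<times> ('a \<Rightarrow>\<^sub>L complex)"

definition triples :: "'a::complex_banach_algebra triple set" where
  "triples = {(P, f, g). (\<forall>c x. blinfun_apply P (c *\<^sub>C x) = scale1 c (P x)) \<and> (\<forall>x. complex_linear (P x)) \<and>
     complex_linear f \<and> complex_linear g}"

definition scale3 :: "complex \<Rightarrow> 'a::real_normed_vector triple \<Rightarrow> 'a triple" where
  "scale3 c = (\<lambda>(P, f, g). (post (blinfun_mult_right c) o\<^sub>L P, scale1 c f, scale1 c g))"

text \<open>
  With \<open>B\<close> the unitization of \<open>A\<close>, this is the dual of the codimension one subbimodule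
  \<open>A \<otimes> A + A \<otimes> 1 + 1 \<otimes> A\<close> of \<open>B \<otimes> B\<close>, which contains \<open>a \<otimes> 1 - 1 \<otimes> a\<close>:
  a triple gives the values of a functional on the three summands.
\<close>

definition triple_bimod :: "('a::complex_banach_algebra, 'a triple) bimod" where
  "triple_bimod =
    \<lparr>carr = triples, zer = 0, add = (+), scl = scale3, nrm = norm,
     lact = (\<lambda>a (P, f, g). (pre (blinfun_mult_left a) o\<^sub>L P, eval_at a o\<^sub>L P, g o\<^sub>L blinfun_mult_left a)),
     ract = (\<lambda>(P, f, g) a. (P o\<^sub>L blinfun_mult_right a, f o\<^sub>L blinfun_mult_right a, blinfun_apply P a))\<rparr>"

lemma norm_scale3_le: "norm (scale3 c T) \<le> cmod c * norm T"
proof -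
  obtain P f g where T: "T = (P, f, g)" by (cases T)
  have "norm (post (blinfun_mult_right c) o\<^sub>L P) \<le> cmod c * norm P"
  proof (rule norm_blinfun_bound)
    show "norm ((post (blinfun_mult_right c) o\<^sub>L P) x) \<le> cmod c * norm P * norm x" for x
      using norm_scale1_le[of c "P x"] mult_left_mono[OF norm_blinfun[of P x], of "cmod c"]
      by (simp add: scale1_def mult.assoc)
  qed simp
  then have "norm (scale3 c T) \<le> norm (cmod c *\<^sub>R T)"
    unfolding T scale3_def norm_Pair scaleR_Pair
    by (auto intro!: real_sqrt_le_mono add_mono power_mono norm_scale1_le simp: norm_Pair)
  then show ?thesis by simp
qed

lemma scale3_scale3: "scale3 c (scale3 d T) = scale3 (c * d) T"
  by (cases T) (auto simp: scale3_def blinfun_mult_right.rep_eq intro!: blinfun_eqI)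

lemma scale3_one: "scale3 1 T = T"
  by (cases T) (auto simp: scale3_def blinfun_mult_right.rep_eq intro!: blinfun_eqI)

text \<open>The missing inequality is the upper bound for \<open>inverse c\<close>, applied to
  \<open>scale3 c T\<close>.\<close>

lemma norm_scale3: "norm (scale3 c T) = cmod c * norm T"
proof (cases "c = 0")
  case True
  then show ?thesis using norm_scale3_le[of c T] by simp
next
  case False
  then have "norm T \<le> cmod (inverse c) * norm (scale3 c T)"
    using norm_scale3_le[of "inverse c" "scale3 c T"] by (simp add: scale3_scale3 scale3_one)
  then show ?thesis
    using False norm_scale3_le[of c T] by (simp add: norm_inverse norm_divide field_simps)
qed

text \<open>Gives completeness of the carrier inside the Banach space of real-linear triples:
  complex linearity is a family of equations between evaluations, which are continuous.\<close>

lemma closed_triples: "closed (triples :: 'a::complex_banach_algebra triple set)"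
proof -
  have eq: "(triples :: 'a triple set) =
      {T. (\<forall>c x y. blinfun_apply (blinfun_apply (fst T) (c *\<^sub>C x)) y = c * blinfun_apply (blinfun_apply (fst T) x) y) \<and>
          (\<forall>c x y. blinfun_apply (blinfun_apply (fst T) x) (c *\<^sub>C y) = c * blinfun_apply (blinfun_apply (fst T) x) y) \<and>
          (\<forall>c x. blinfun_apply (fst (snd T)) (c *\<^sub>C x) = c * blinfun_apply (fst (snd T)) x) \<and>
          (\<forall>c x. blinfun_apply (snd (snd T)) (c *\<^sub>C x) = c * blinfun_apply (snd (snd T)) x)}"
    by (auto simp: triples_def complex_linear_def intro!: blinfun_eqI)
  show ?thesis
    unfolding eq
    by (intro closed_Collect_conj closed_Collect_all closed_Collect_eq continuous_on_mult
        blinfun.continuous_on continuous_on_const continuous_on_fst continuous_on_snd continuous_on_id)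
qed

lemma zero_in_triples: "0 \<in> triples"
  by (auto simp: triples_def complex_linear_def zero_prod_def intro!: blinfun_eqI)

lemma add_in_triples: "S \<in> triples \<Longrightarrow> T \<in> triples \<Longrightarrow> S + T \<in> triples"
  by (auto simp: triples_def complex_linear_def blinfun.add_left algebra_simps intro!: blinfun_eqI)

lemma scale3_in_triples: "T \<in> triples \<Longrightarrow> scale3 c T \<in> triples"
  by (auto simp: triples_def scale3_def complex_linear_def blinfun_mult_right.rep_eq
      algebra_simps intro!: blinfun_eqI)

lemma norm_triple_parts:
  "norm P \<le> norm (P, f, g)" "norm f \<le> norm (P, f, g)" "norm g \<le> norm (P, f, g)"
  using norm_fst_le[of P "(f, g)"] norm_snd_le[of "(f, g)" P] norm_fst_le[of f g]
    norm_snd_le[of g f] by linarith+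

lemma norm_triple_le: "norm (P, f, g) \<le> norm P + norm f + norm g"
  using norm_Pair_le[of P "(f, g)"] norm_Pair_le[of f g] by simp

lemma banach_bimodule_triple: "banach_bimodule (triple_bimod :: ('a::complex_banach_algebra, _) bimod)"
proof
  let ?X = "triple_bimod :: ('a, _) bimod"
  have sub: "sub ?X S T = S - T" for S T
    by (cases S, cases T) (auto simp: sub_def triple_bimod_def scale3_def blinfun_mult_right.rep_eq
        blinfun.bilinear_simps intro!: blinfun_eqI)
  show "\<exists>x\<in>carr ?X. (\<lambda>n. nrm ?X (sub ?X (s n) x)) \<longlonglongrightarrow> 0"
    if s: "\<And>n. s n \<in> carr ?X" and
      cauchy: "\<And>e. 0 < e \<Longrightarrow> \<exists>N. \<forall>m\<ge>N. \<forall>n\<ge>N. nrm ?X (sub ?X (s m) (s n)) < e" for s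
  proof -
    have "Cauchy s" using cauchy unfolding sub by (intro CauchyI) (simp add: triple_bimod_def)
    then obtain T where T: "s \<longlonglongrightarrow> T" using Cauchy_convergent convergent_def by blast
    then have "T \<in> triples"
      by (rule closed_sequentially[OF closed_triples, rotated]) (use s in \<open>simp add: triple_bimod_def\<close>)
    moreover have "(\<lambda>n. norm (s n - T)) \<longlonglongrightarrow> 0"
      using T by (simp add: tendsto_norm_zero_iff LIM_zero_iff)
    ultimately show ?thesis unfolding sub by (auto simp: triple_bimod_def)
  qed
  have norm_mult_ops: "norm (blinfun_mult_left a :: 'a \<Rightarrow>\<^sub>L 'a) \<le> norm a"
    "norm (blinfun_mult_right a :: 'a \<Rightarrow>\<^sub>L 'a) \<le> norm a" for a
    by (auto intro!: norm_blinfun_bound simp: blinfun_mult_right.rep_eq norm_mult_ineq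
        order_trans[OF norm_mult_ineq] mult.commute)
  have comp: "norm (f o\<^sub>L R) \<le> b * norm f" if "norm R \<le> b" for f :: "'a \<Rightarrow>\<^sub>L 'c::real_normed_vector" and R :: "'a \<Rightarrow>\<^sub>L 'a" and b
    using norm_blinfun_compose[of f R] mult_right_mono[OF that norm_ge_zero[of f]]
    by (simp add: mult.commute)
  \<comment> \<open>Each of the three components has norm at most \<open>norm a * norm T\<close>,
    whence the factor 3; the actions need not be contractive.\<close>
  have lbd: "norm (lact ?X a T) \<le> 3 * norm a * norm T" for a T
  proof -
    obtain P f g where T: "T = (P, f, g)" by (cases T)
    have "norm (pre (blinfun_mult_left a) o\<^sub>L P) \<le> norm a * norm P"
    proof (rule norm_blinfun_bound)
      fix x
      have "norm (P x o\<^sub>L blinfun_mult_left a) \<le> norm a * norm (P x)"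
        by (rule comp[OF norm_mult_ops(1)])
      also have "\<dots> \<le> norm a * (norm P * norm x)" by (intro mult_left_mono norm_blinfun) simp
      finally show "norm ((pre (blinfun_mult_left a) o\<^sub>L P) x) \<le> norm a * norm P * norm x"
        by (simp add: mult.assoc)
    qed simp
    moreover have "norm (eval_at a o\<^sub>L P) \<le> norm a * norm P"
    proof (rule norm_blinfun_bound)
      fix x
      have "norm (P x a) \<le> norm (P x) * norm a" by (rule norm_blinfun)
      also have "\<dots> \<le> (norm P * norm x) * norm a" by (intro mult_right_mono norm_blinfun) simp
      finally show "norm ((eval_at a o\<^sub>L P) x) \<le> norm a * norm P * norm x"
        by (simp add: mult.commute mult.left_commute)
    qed simp
    moreover have "norm (g o\<^sub>L blinfun_mult_left a) \<le> norm a * norm g"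
      by (rule comp[OF norm_mult_ops(1)])
    moreover have "norm a * norm P \<le> norm a * norm T" "norm a * norm g \<le> norm a * norm T"
      unfolding T by (intro mult_left_mono norm_triple_parts norm_ge_zero)+
    ultimately show ?thesis
      using norm_triple_le[of "pre (blinfun_mult_left a) o\<^sub>L P" "eval_at a o\<^sub>L P" "g o\<^sub>L blinfun_mult_left a"]
      by (simp add: T triple_bimod_def)
  qed
  have rbd: "norm (ract ?X T a) \<le> 3 * norm a * norm T" for a T
  proof -
    obtain P f g where T: "T = (P, f, g)" by (cases T)
    have "norm (P o\<^sub>L blinfun_mult_right a) \<le> norm a * norm P" "norm (f o\<^sub>L blinfun_mult_right a) \<le> norm a * norm f"
      by (rule comp[OF norm_mult_ops(2)])+
    moreover have "norm (P a) \<le> norm a * norm P" using norm_blinfun[of P a] by (simp add: mult.commute)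
    moreover have "norm a * norm P \<le> norm a * norm T" "norm a * norm f \<le> norm a * norm T"
      unfolding T by (intro mult_left_mono norm_triple_parts norm_ge_zero)+
    ultimately show ?thesis
      using norm_triple_le[of "P o\<^sub>L blinfun_mult_right a" "f o\<^sub>L blinfun_mult_right a" "P a"]
      by (simp add: T triple_bimod_def)
  qed
  show "\<exists>C. \<forall>a. \<forall>x\<in>carr ?X. nrm ?X (lact ?X a x) \<le> C * norm a * nrm ?X x"
    using lbd by (intro exI[of _ 3]) (simp add: triple_bimod_def)
  show "\<exists>C. \<forall>a. \<forall>x\<in>carr ?X. nrm ?X (ract ?X x a) \<le> C * norm a * nrm ?X x"
    using rbd by (intro exI[of _ 3]) (simp add: triple_bimod_def)
  show "\<exists>y\<in>carr ?X. add ?X x y = zer ?X" if "x \<in> carr ?X" for x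
    using that scale3_in_triples[of x "-1"] sub[of x x]
    by (auto simp: triple_bimod_def sub_def)
qed (auto simp: triple_bimod_def zero_in_triples add_in_triples scale3_in_triples norm_scale3
    scale3_scale3 scale3_one norm_triangle_ineq add.assoc add.commute,
    auto simp: triples_def complex_linear_def scale3_def blinfun_mult_right.rep_eq mult_scaleC_left
    mult_scaleC_right blinfun.bilinear_simps algebra_simps intro!: blinfun_eqI)

text \<open>The pair \<open>(x, s)\<close> stands for \<open>x + s 1\<close> in the unitization.\<close>

definition encode :: "'a::complex_banach_algebra triple \<Rightarrow> 'a bimod_universe" where
  "encode = (\<lambda>(P, f, g). {\<lambda>((x, s), (y, t)).
     blinfun_apply (blinfun_apply P x) y + t * blinfun_apply f x + s * blinfun_apply g y})"

text \<open>The arguments \<open>((x, 0), (y, 0))\<close>, \<open>((x, 0), (0, 1))\<close> and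
  \<open>((0, 1), (x, 0))\<close> represent \<open>x \<otimes> y\<close>,
  \<open>x \<otimes> 1\<close> and \<open>1 \<otimes> x\<close>, and evaluation there recovers the
  three components.\<close>

lemma inj_encode: "inj encode"
proof (rule injI, clarsimp simp: encode_def)
  fix P P' :: "'a \<Rightarrow>\<^sub>L 'a \<Rightarrow>\<^sub>L complex" and f f' g g' :: "'a \<Rightarrow>\<^sub>L complex"
  assume eq: "(\<lambda>((x, s), (y, t)). blinfun_apply (blinfun_apply P x) y + t * f x + s * g y) =
    (\<lambda>((x, s), (y, t)). blinfun_apply (blinfun_apply P' x) y + t * f' x + s * g' y)"
  note * = fun_cong[OF eq]
  have "P x y = P' x y" for x y using *[of "((x, 0), (y, 0))"] by simp
  moreover have "f x = f' x" for x using *[of "((x, 0), (0, 1))"] by simp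
  moreover have "g x = g' x" for x using *[of "((0, 1), (x, 0))"] by simp
  ultimately show "P = P' \<and> f = f' \<and> g = g'" by (auto intro!: blinfun_eqI)
qed

section \<open>The derivation into the dual of the coded bimodule\<close>

abbreviation coded_bimod :: "('a::complex_banach_algebra, 'a bimod_universe) bimod" where
  "coded_bimod \<equiv> transport encode triple_bimod"

text \<open>The element \<open>a \<otimes> 1 - 1 \<otimes> a\<close> acting on a decoded triple
  \<open>(P, f, g)\<close> by \<open>f a - g a\<close>. The restriction to the carrier makes it
  extensional, as members of the dual must be.\<close>

definition coded_derivation :: "'a::complex_banach_algebra \<Rightarrow> 'a bimod_universe \<Rightarrow> complex" where
  "coded_derivation a = (\<lambda>u\<in>carr coded_bimod.
     blinfun_apply (fst (snd (inv encode u))) a - blinfun_apply (snd (snd (inv encode u))) a)"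

lemma carr_coded: "carr coded_bimod = encode ` triples"
  by (simp add: transport_sel[OF inj_encode]) (simp add: triple_bimod_def)

lemma coded_derivation_apply:
  "T \<in> triples \<Longrightarrow> coded_derivation a (encode T) =
    blinfun_apply (fst (snd T)) a - blinfun_apply (snd (snd T)) a"
  by (simp add: coded_derivation_def carr_coded inj_encode)

lemma coded_derivation_extensional: "coded_derivation a \<in> extensional (encode ` triples)"
  by (simp add: coded_derivation_def carr_coded)

lemma triples_scaleC:
  assumes "T \<in> triples"
  shows "blinfun_apply (fst (snd T)) (c *\<^sub>C a) = c * blinfun_apply (fst (snd T)) a"
    "blinfun_apply (snd (snd T)) (c *\<^sub>C a) = c * blinfun_apply (snd (snd T)) a"
  using assms by (auto simp: triples_def complex_linear_def)

lemma triple_bimod_sel: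
  "carr triple_bimod = triples" "add triple_bimod = (+)" "scl triple_bimod = scale3" "nrm triple_bimod = norm"
  "lact triple_bimod a (P, f, g) =
    (pre (blinfun_mult_left a) o\<^sub>L P, eval_at a o\<^sub>L P, g o\<^sub>L blinfun_mult_left a)"
  "ract triple_bimod (P, f, g) a = (P o\<^sub>L blinfun_mult_right a, f o\<^sub>L blinfun_mult_right a, blinfun_apply P a)"
  by (simp_all add: triple_bimod_def)

lemma coded_derivation_bound:
  assumes "T \<in> triples"
  shows "cmod (coded_derivation a (encode T)) \<le> 2 * norm a * norm T"
proof -
  obtain P f g where T: "T = (P, f, g)" by (cases T)
  have "cmod (f a) \<le> norm T * norm a" "cmod (g a) \<le> norm T * norm a"
    unfolding T by (intro order_trans[OF norm_blinfun] mult_right_mono norm_triple_parts norm_ge_zero)+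
  then show ?thesis
    using norm_triangle_ineq4[of "f a" "g a"] assms
    by (simp add: coded_derivation_apply T mult.commute mult.left_commute)
qed

lemma coded_derivation_dual: "coded_derivation a \<in> dual_carr coded_bimod"
proof -
  note sel = transport_sel[OF inj_encode] triple_bimod_sel
  have "coded_derivation a (encode (S + T)) = coded_derivation a (encode S) + coded_derivation a (encode T)"
    if "S \<in> triples" "T \<in> triples" for S T
    using that by (simp add: coded_derivation_apply add_in_triples blinfun.add_left)
  moreover have "coded_derivation a (encode (scale3 c T)) = c * coded_derivation a (encode T)"
    if "T \<in> triples" for c T
    using that by (cases T) (simp add: coded_derivation_apply scale3_in_triples,
        simp add: scale3_def algebra_simps)
  moreover have "\<exists>C. \<forall>T\<in>triples. cmod (coded_derivation a (encode T)) \<le> C * norm T"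
    using coded_derivation_bound by blast
  ultimately show ?thesis
    by (auto simp: dual_carr_def sel coded_derivation_extensional)
qed

lemma bounded_derivation_coded:
  "bounded_derivation (dual_bimodule coded_bimod) (coded_derivation :: 'a::complex_banach_algebra \<Rightarrow> _)"
proof -
  let ?X = "coded_bimod :: ('a, _) bimod" and ?D = "coded_derivation :: 'a \<Rightarrow> _"
  interpret banach_bimodule ?X
    by (rule banach_bimodule_transport[OF inj_encode banach_bimodule_triple])
  note sel = transport_sel[OF inj_encode] triple_bimod_sel
  have ext: "f = g" if "f \<in> extensional (encode ` triples)" "g \<in> extensional (encode ` triples)"
    "\<And>T. T \<in> triples \<Longrightarrow> f (encode T) = g (encode T)" for f g :: "'a bimod_universe \<Rightarrow> complex"
    using that by (intro extensionalityI) auto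
  note D_ext = coded_derivation_extensional
  show ?thesis
    unfolding bounded_derivation_def
  proof (intro conjI allI)
    show "?D a \<in> carr (dual_bimodule ?X)" for a
      using coded_derivation_dual by (simp add: dual_bimodule_def)
    show "?D (a + b) = add (dual_bimodule ?X) (?D a) (?D b)" for a b
      by (rule ext) (auto simp: D_ext dual_bimodule_def sel coded_derivation_apply blinfun.add_right)
    show "?D (c *\<^sub>C a) = scl (dual_bimodule ?X) c (?D a)" for c a
      by (rule ext) (auto simp: D_ext dual_bimodule_def sel coded_derivation_apply triples_scaleC
          algebra_simps)
    show "\<exists>C. \<forall>a. nrm (dual_bimodule ?X) (?D a) \<le> C * norm a"
    proof (intro exI[of _ 2] allI dual_nrm_le)
      fix a :: 'a and x assume "x \<in> carr ?X"
      then show "cmod (?D a x) \<le> 2 * norm a * nrm ?X x"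
        using coded_derivation_bound by (auto simp: sel)
    qed simp
    show "?D (a * b) = add (dual_bimodule ?X) (lact (dual_bimodule ?X) a (?D b)) (ract (dual_bimodule ?X) (?D a) b)" for a b
    proof (rule ext)
      fix T :: "'a triple" assume T: "T \<in> triples"
      have T': "ract triple_bimod T a \<in> triples" "lact triple_bimod b T \<in> triples"
        using T banach_bimodule.ract_closed[OF banach_bimodule_triple, of T a]
          banach_bimodule.lact_closed[OF banach_bimodule_triple, of T b] by (simp_all add: sel)
      have "add (dual_bimodule ?X) (lact (dual_bimodule ?X) a (?D b)) (ract (dual_bimodule ?X) (?D a) b) (encode T)
        = ?D b (encode (ract triple_bimod T a)) + ?D a (encode (lact triple_bimod b T))"
        using T by (simp add: dual_bimodule_def transport_sel[OF inj_encode]) (simp add: sel)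
      \<comment> \<open>For \<open>T = (P, f, g)\<close> the two terms are
        \<open>f (a * b) - P a b\<close> and \<open>P a b - g (a * b)\<close>, so the mixed term
        cancels.\<close>
      also have "\<dots> = ?D (a * b) (encode T)"
        using T T' by (cases T) (simp add: coded_derivation_apply, simp add: sel blinfun_mult_right.rep_eq)
      finally show "?D (a * b) (encode T) =
        add (dual_bimodule ?X) (lact (dual_bimodule ?X) a (?D b)) (ract (dual_bimodule ?X) (?D a) b) (encode T)" ..
    qed (simp_all add: D_ext dual_bimodule_def sel)
  qed
qed

section \<open>Bounded approximate identities\<close>

text \<open>\<open>blinfun_mult_right x\<close> has its argument on the right, so it is
  \<open>y \<mapsto> x * y\<close>. The second interpretation, with the two operators exchanged, is
  the opposite algebra.\<close>

interpretation left_ops: product_operators blinfun_mult_right blinfun_mult_left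
  by unfold_locales
    (simp_all add: blinfun_mult_right.rep_eq mult.assoc norm_mult_ineq mult_scaleC_left mult_scaleC_right)

interpretation right_ops: product_operators blinfun_mult_left blinfun_mult_right
  by unfold_locales
    (simp_all add: blinfun_mult_right.rep_eq mult.assoc mult_scaleC_left mult_scaleC_right,
      metis mult.commute norm_mult_ineq)

section \<open>Slices of the approximating elements of the bidual\<close>

lemma elementary_triples:
  assumes "complex_linear f" "complex_linear g"
  shows "(tensor f g, 0, 0) \<in> triples" "(0, f, 0) \<in> triples" "(0, 0, g) \<in> triples"
  using assms by (auto simp: triples_def complex_linear_def algebra_simps intro!: blinfun_eqI)

text \<open>The implementing functional is evaluated on triples with one nonzero component. On
  \<open>(0, 0, g)\<close> only the left action survives and on \<open>(0, f, 0)\<close> only the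
  right one, so closeness at \<open>a\<close> becomes the statements about \<open>G\<close> and
  \<open>P\<close>; the commutator bound is tested on \<open>(tensor f g, 0, 0)\<close>.\<close>

lemma bounded_approx_amenable_slices:
  assumes "boundedly_approx_amenable TYPE('a::complex_banach_algebra)"
  obtains C where "0 \<le> C"
    "\<And>(a :: 'a) e. 0 < e \<Longrightarrow> \<exists>M P G N. left_ops.slice_bounds C N M P G \<and>
      (\<forall>g. complex_linear g \<longrightarrow> cmod (G (g o\<^sub>L blinfun_mult_left a) - g a) \<le> e * norm g) \<and>
      (\<forall>f. complex_linear f \<longrightarrow> cmod (P (f o\<^sub>L blinfun_mult_right a) - f a) \<le> e * norm f)"
proof -
  let ?X = "coded_bimod :: ('a, _) bimod" and ?D = "coded_derivation :: 'a \<Rightarrow> _"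
  interpret banach_bimodule ?X
    by (rule banach_bimodule_transport[OF inj_encode banach_bimodule_triple])
  note sel = transport_sel[OF inj_encode] triple_bimod_sel
  have inner: "boundedly_approx_inner (dual_bimodule ?X) ?D"
    using assms bounded_derivation_coded banach_bimodule_axioms
    unfolding boundedly_approx_amenable_def boundedly_approx_amenable_over_def by blast
  obtain C where C: "0 \<le> C" and approx: "\<And>a e. 0 < e \<Longrightarrow> \<exists>m\<in>dual_carr ?X.
      (\<forall>b. \<forall>x\<in>carr ?X. cmod (m (ract ?X x b) - m (lact ?X b x)) \<le> C * norm b * nrm ?X x) \<and>
      (\<forall>x\<in>carr ?X. cmod (m (ract ?X x a) - m (lact ?X a x) - ?D a x) \<le> e * nrm ?X x)"
    using boundedly_approx_inner_dualD[OF inner coded_derivation_dual] by metis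
  have "\<exists>M P G N. left_ops.slice_bounds C N M P G \<and>
      (\<forall>g. complex_linear g \<longrightarrow> cmod (G (g o\<^sub>L blinfun_mult_left a) - g a) \<le> e * norm g) \<and>
      (\<forall>f. complex_linear f \<longrightarrow> cmod (P (f o\<^sub>L blinfun_mult_right a) - f a) \<le> e * norm f)"
    if e: "0 < e" for a :: 'a and e
  proof -
    obtain m where m: "m \<in> dual_carr ?X"
      and inn: "\<And>b x. x \<in> carr ?X \<Longrightarrow> cmod (m (ract ?X x b) - m (lact ?X b x)) \<le> C * norm b * nrm ?X x"
      and near: "\<And>x. x \<in> carr ?X \<Longrightarrow> cmod (m (ract ?X x a) - m (lact ?X a x) - ?D a x) \<le> e * nrm ?X x"
      using approx[OF e, of a] by blast
    obtain N where N: "0 \<le> N" "\<And>x. x \<in> carr ?X \<Longrightarrow> cmod (m x) \<le> N * nrm ?X x"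
      using dual_bound[OF m] by blast
    define n where "n T = m (encode T)" for T
    have n_add: "n (S + T) = n S + n T" if "S \<in> triples" "T \<in> triples" for S T
      using m that unfolding dual_carr_def n_def by (auto simp: sel)
    have n_scale: "n (scale3 c T) = c * n T" if "T \<in> triples" for c T
      using m that unfolding dual_carr_def n_def by (auto simp: sel)
    have n_bound: "cmod (n T) \<le> N * norm T" if "T \<in> triples" for T
      using N(2)[of "encode T"] that by (simp add: sel n_def)
    have n_inn: "cmod (n (ract triple_bimod T b) - n (lact triple_bimod b T)) \<le> C * norm b * norm T"
      if "T \<in> triples" for T b
      using inn[of "encode T" b] that by (simp add: transport_sel[OF inj_encode] n_def) (simp add: sel)
    have n_near: "cmod (n (ract triple_bimod T a) - n (lact triple_bimod a T) -
        (fst (snd T) a - snd (snd T) a)) \<le> e * norm T"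
      if "T \<in> triples" for T
      using near[of "encode T"] that coded_derivation_apply[OF that, of a]
      by (simp add: transport_sel[OF inj_encode] n_def) (simp add: sel)
    have n0: "n (0, 0, 0) = 0"
      using n_bound[OF zero_in_triples] by (simp add: zero_prod_def)
    define M where "M f g = n (tensor f g, 0, 0)" for f g
    define P where "P f = n (0, f, 0)" for f
    define G where "G g = n (0, 0, g)" for g
    have "left_ops.slice_bounds C N M P G"
      unfolding left_ops.slice_bounds_def
    proof (intro conjI allI impI N(1))
      fix f g :: "'a \<Rightarrow>\<^sub>L complex" and w :: 'a
      assume fg: "complex_linear f" "complex_linear g"
      note el = elementary_triples[OF fg]
      have nt: "norm (tensor f g, 0 :: 'a \<Rightarrow>\<^sub>L complex, 0 :: 'a \<Rightarrow>\<^sub>L complex) \<le> norm f * norm g"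
        using norm_tensor[of f g] by (simp add: norm_Pair)
      show "cmod (M f g) \<le> N * norm f * norm g"
        unfolding M_def mult.assoc by (rule order_trans[OF n_bound[OF el(1)] mult_left_mono[OF nt N(1)]])
      show "cmod (P f) \<le> N * norm f" "cmod (G g) \<le> N * norm g"
        using n_bound[OF el(2)] n_bound[OF el(3)] by (simp_all add: P_def G_def norm_Pair)
      let ?f = "f o\<^sub>L blinfun_mult_right w" and ?g = "g o\<^sub>L blinfun_mult_left w"
      have f': "complex_linear ?f" "complex_linear ?g"
        using fg by (auto simp: complex_linear_def blinfun_mult_right.rep_eq mult_scaleC_left mult_scaleC_right)
      \<comment> \<open>The second summand arises because
        \<open>w (1 \<otimes> y) = w \<otimes> y\<close>: the right action turns the bilinear form
        into the functional \<open>f w * g y\<close> on \<open>1 \<otimes> A\<close>. Dually,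
        \<open>(x \<otimes> 1) w = x \<otimes> w\<close> brings in \<open>P\<close> for the left
        action.\<close>
      have "ract triple_bimod (tensor f g, 0, 0) w = (tensor ?f g, 0, 0) + scale3 (f w) (0, 0, g)"
        by (auto simp: sel scale3_def blinfun_mult_right.rep_eq intro!: blinfun_eqI)
      then have r: "n (ract triple_bimod (tensor f g, 0, 0) w) = M ?f g + f w * G g"
        using elementary_triples[OF f'(1) fg(2)] el
        by (simp add: n_add n_scale scale3_in_triples M_def G_def)
      have "lact triple_bimod w (tensor f g, 0, 0) = (tensor f ?g, 0, 0) + scale3 (g w) (0, f, 0)"
        by (auto simp: sel scale3_def blinfun_mult_right.rep_eq intro!: blinfun_eqI)
      then have l: "n (lact triple_bimod w (tensor f g, 0, 0)) = M f ?g + g w * P f"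
        using elementary_triples[OF fg(1) f'(2)] el
        by (simp add: n_add n_scale scale3_in_triples M_def P_def)
      have "cmod (M ?f g + f w * G g - (M f ?g + g w * P f)) \<le> C * norm w * (norm f * norm g)"
        using n_inn[OF el(1), of w] unfolding r l
        by (rule order_trans) (use nt C in \<open>intro mult_left_mono, auto\<close>)
      then show "cmod (G g * f w + M ?f g - M f ?g - P f * g w) \<le> C * norm w * norm f * norm g"
        by (simp add: algebra_simps)
    qed
    moreover have "cmod (G (g o\<^sub>L blinfun_mult_left a) - g a) \<le> e * norm g" if "complex_linear g" for g
      using n_near[OF elementary_triples(3)[OF that that]]
      by (simp add: sel G_def n0 norm_Pair norm_minus_commute)
    moreover have "cmod (P (f o\<^sub>L blinfun_mult_right a) - f a) \<le> e * norm f" if "complex_linear f" for f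
      using n_near[OF elementary_triples(2)[OF that that]]
      by (simp add: sel P_def n0 norm_Pair)
    ultimately show ?thesis by blast
  qed
  then show thesis using that C by blast
qed

text \<open>Interchanging the tensor factors passes to the opposite product, swaps \<open>P\<close>
  with \<open>G\<close>, and only changes the sign of the commutator expression. Thus the same
  element of the bidual serves both sides.\<close>

lemma slice_bounds_opposite:
  assumes "left_ops.slice_bounds C N M P G"
  shows "right_ops.slice_bounds C N (\<lambda>f g. M g f) G P"
  unfolding right_ops.slice_bounds_def
proof (intro conjI allI impI)
  fix f g :: "'a \<Rightarrow>\<^sub>L complex" and w :: 'a
  assume fg: "complex_linear f" "complex_linear g"
  note L = assms[unfolded left_ops.slice_bounds_def, THEN conjunct2, rule_format]
  show "cmod (M g f) \<le> N * norm f * norm g" "cmod (G f) \<le> N * norm f" "cmod (P g) \<le> N * norm g"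
    using L[OF fg(2,1)] by (simp_all add: mult.commute mult.left_commute)
  have "P g * f w + M g (f o\<^sub>L blinfun_mult_left w) - M (g o\<^sub>L blinfun_mult_right w) f - G f * g w =
      - (G f * g w + M (g o\<^sub>L blinfun_mult_right w) f - M g (f o\<^sub>L blinfun_mult_left w) - P g * f w)"
    by simp
  then show "cmod (P g * f w + M g (f o\<^sub>L blinfun_mult_left w) - M (g o\<^sub>L blinfun_mult_right w) f - G f * g w)
      \<le> C * norm w * norm f * norm g"
    using L[OF fg(2,1), of w] by (metis norm_minus_cancel mult.assoc mult.commute)
qed (use assms in \<open>simp add: left_ops.slice_bounds_def\<close>)

section \<open>From approximate units on finite sets to a net\<close>

lemma has_bounded_aiI:
  assumes "\<And>S e. finite S \<Longrightarrow> 0 < e \<Longrightarrow>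
    \<exists>u::'a::complex_banach_algebra. norm u \<le> B \<and> (\<forall>a\<in>S. norm (u * a - a) < e \<and> norm (a * u - a) < e)"
  shows "has_bounded_ai TYPE('a)"
proof -
  have "\<exists>u::'a. finite S \<longrightarrow> norm u \<le> B \<and>
      (\<forall>a\<in>S. norm (u * a - a) < inverse (Suc n) \<and> norm (a * u - a) < inverse (Suc n))" for S n
    using assms[of S "inverse (Suc n)"] by auto
  then obtain u :: "'a set \<Rightarrow> nat \<Rightarrow> 'a" where u: "\<And>S n. finite S \<Longrightarrow> norm (u S n) \<le> B"
    "\<And>S n a. finite S \<Longrightarrow> a \<in> S \<Longrightarrow> norm (u S n * a - a) < inverse (Suc n)"
    "\<And>S n a. finite S \<Longrightarrow> a \<in> S \<Longrightarrow> norm (a * u S n - a) < inverse (Suc n)"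
    by metis
  \<comment> \<open>Index by pairs of a finite set and a tolerance \<open>inverse (Suc n)\<close>,
    positive already for \<open>n = 0\<close>; both grow along the product filter.\<close>
  let ?I = "finite_subsets_at_top (UNIV :: 'a set) \<times>\<^sub>F sequentially"
  define F where "F = filtermap (case_prod u) ?I"
  have ev: "\<forall>\<^sub>F p in ?I. (finite (fst p) \<and> a \<in> fst p) \<and> N \<le> snd p" for a :: 'a and N
  proof (rule eventually_prodI[OF _ eventually_ge_at_top])
    show "\<forall>\<^sub>F S in finite_subsets_at_top (UNIV :: 'a set). finite S \<and> a \<in> S"
      by (auto simp: eventually_finite_subsets_at_top intro!: exI[of _ "{a}"])
  qed
  have lim: "((\<lambda>u. h u) \<longlongrightarrow> a) F"
    if h: "\<And>S n. finite S \<Longrightarrow> a \<in> S \<Longrightarrow> norm (h (u S n) - a) < inverse (Suc n)" for h and a :: 'a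
  proof (rule tendstoI)
    fix e :: real assume "0 < e"
    then obtain N where N: "inverse (Suc N) < e" using reals_Archimedean by blast
    have "norm (h (u S n) - a) < e" if "finite S" "a \<in> S" "N \<le> n" for S n
    proof -
      have "inverse (real (Suc n)) \<le> inverse (real (Suc N))"
        using that(3) by (intro le_imp_inverse_le) auto
      then show ?thesis using h[OF that(1,2), of n] N by linarith
    qed
    then show "\<forall>\<^sub>F u in F. dist (h u) a < e"
      unfolding F_def eventually_filtermap dist_norm
      by (intro eventually_mono[OF ev[of a N]]) auto
  qed
  have "F \<noteq> bot"
    by (simp add: F_def filtermap_bot_iff prod_filter_eq_bot)
  moreover have "\<forall>\<^sub>F u in F. norm u \<le> B"
    unfolding F_def eventually_filtermap using u(1)
    by (intro eventually_mono[OF ev[of 0 0]]) auto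
  moreover have "((\<lambda>u. u * a) \<longlongrightarrow> a) F" "((\<lambda>u. a * u) \<longlongrightarrow> a) F" for a
    using u(2,3) by (auto intro: lim)
  ultimately show ?thesis unfolding has_bounded_ai_def by blast
qed

text \<open>\<open>1 - u = (1 - r) (1 - l)\<close>, where both factors are bounded.\<close>

lemma has_bounded_ai_one_sided:
  assumes B: "0 < B" "0 < B'"
    and left: "\<And>S e. finite S \<Longrightarrow> 0 < e \<Longrightarrow> \<exists>l::'a::complex_banach_algebra. norm l \<le> B \<and> (\<forall>a\<in>S. norm (l * a - a) < e)"
    and right: "\<And>S e. finite S \<Longrightarrow> 0 < e \<Longrightarrow> \<exists>r::'a. norm r \<le> B' \<and> (\<forall>a\<in>S. norm (a * r - a) < e)"
  shows "has_bounded_ai TYPE('a)"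
proof (rule has_bounded_aiI[where B = "B + B' + B * B'"])
  fix S :: "'a set" and e :: real
  assume S: "finite S" and e: "0 < e"
  \<comment> \<open>The two errors of \<open>?u\<close> are below \<open>d + B' * d\<close> and
    \<open>d + B * d\<close>; this \<open>d\<close> keeps both under \<open>e\<close>.\<close>
  define d where "d = e / (1 + B + B')"
  have d: "0 < d" and "d * (1 + B + B') = e"
    using B e by (simp_all add: d_def)
  then have de: "d + B * d + B' * d = e" by (simp add: algebra_simps)
  obtain l where l: "norm l \<le> B" "\<And>a. a \<in> S \<Longrightarrow> norm (l * a - a) < d" using left[OF S d] by blast
  obtain r where r: "norm r \<le> B'" "\<And>a. a \<in> S \<Longrightarrow> norm (a * r - a) < d" using right[OF S d] by blast
  have mult: "norm (x * y) \<le> b * c" if "norm x \<le> b" "norm y \<le> c" for x y :: 'a and b c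
    using that by (intro order_trans[OF norm_mult_ineq] mult_mono) (auto intro: order_trans[OF norm_ge_zero])
  let ?u = "r + l - r * l"
  have "norm ?u \<le> B + B' + B * B'"
    using norm_triangle_ineq4[of "r + l" "r * l"] norm_triangle_ineq[of r l] mult[OF r(1) l(1)] l(1) r(1)
    by (simp add: mult.commute)
  moreover have "norm (?u * a - a) < e" "norm (a * ?u - a) < e" if a: "a \<in> S" for a
  proof -
    have pos: "0 < B * d" "0 < B' * d" using B d by simp_all
    have "?u * a - a = (l * a - a) - r * (l * a - a)" by (simp add: algebra_simps)
    then have "norm (?u * a - a) \<le> norm (l * a - a) + norm (r * (l * a - a))"
      using norm_triangle_ineq4 by metis
    then show "norm (?u * a - a) < e"
      using mult[OF r(1) less_imp_le[OF l(2)[OF a]]] l(2)[OF a] de pos by linarith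
    have "a * ?u - a = (a * r - a) - (a * r - a) * l" by (simp add: algebra_simps)
    then have "norm (a * ?u - a) \<le> norm (a * r - a) + norm ((a * r - a) * l)"
      using norm_triangle_ineq4 by metis
    then show "norm (a * ?u - a) < e"
      using mult[OF less_imp_le[OF r(2)[OF a]] l(1)] r(2)[OF a] de pos
      by (simp add: mult.commute[of d])
  qed
  ultimately show "\<exists>u. norm u \<le> B + B' + B * B' \<and>
      (\<forall>a\<in>S. norm (u * a - a) < e \<and> norm (a * u - a) < e)" by blast
qed

theorem theorem3p3:
  assumes "boundedly_approx_amenable TYPE('a::complex_banach_algebra)"
    and "has_multiplier_bounded_left_ai TYPE('a)"
    and "has_multiplier_bounded_right_ai TYPE('a)"
  shows "has_bounded_ai TYPE('a)"
proof -
  obtain C where C: "0 \<le> C" and slices: "\<And>(a :: 'a) e. 0 < e \<Longrightarrow> \<exists>M P G N. left_ops.slice_bounds C N M P G \<and>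
      (\<forall>g. complex_linear g \<longrightarrow> cmod (G (g o\<^sub>L blinfun_mult_left a) - g a) \<le> e * norm g) \<and>
      (\<forall>f. complex_linear f \<longrightarrow> cmod (P (f o\<^sub>L blinfun_mult_right a) - f a) \<le> e * norm f)"
    using bounded_approx_amenable_slices[OF assms(1)] by blast
  obtain F :: "'a filter" and K where F: "F \<noteq> bot" "\<And>a. ((\<lambda>f. f * a) \<longlongrightarrow> a) F"
    "\<forall>\<^sub>F f in F. \<forall>a. norm (f * a) \<le> K * norm a"
    using assms(2) unfolding has_multiplier_bounded_left_ai_def by blast
  obtain F' :: "'a filter" and K' where F': "F' \<noteq> bot" "\<And>a. ((\<lambda>f. a * f) \<longlongrightarrow> a) F'"
    "\<forall>\<^sub>F f in F'. \<forall>a. norm (a * f) \<le> K' * norm a"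
    using assms(3) unfolding has_multiplier_bounded_right_ai_def by blast
  have "\<exists>B>0. \<forall>a::'a. \<forall>e>0. \<exists>r. norm r \<le> B \<and> norm (blinfun_mult_right r a - a) < e"
  proof (rule left_ops.bounded_units[OF C _ F(1)])
    show "\<exists>M P G N. left_ops.slice_bounds C N M P G \<and>
        (\<forall>g. complex_linear g \<longrightarrow> cmod (G (g o\<^sub>L blinfun_mult_left a) - g a) \<le> e * norm g)"
      if "0 < e" for a :: 'a and e using slices[OF that, of a] by blast
  qed (use F in \<open>simp_all add: blinfun_mult_right.rep_eq\<close>)
  then obtain B where B: "0 < B"
    and left: "\<And>(a::'a) e. 0 < e \<Longrightarrow> \<exists>r. norm r \<le> B \<and> norm (blinfun_mult_right r a - a) < e" by blast
  have "\<exists>B>0. \<forall>a::'a. \<forall>e>0. \<exists>r. norm r \<le> B \<and> norm (blinfun_mult_left r a - a) < e"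
  \<comment> \<open>In the opposite algebra the old \<open>P\<close> takes the role of
    \<open>G\<close>, so \<open>a P \<approx> a\<close> supplies the hypothesis on one-sided units,
    and the right approximate identity becomes a left one.\<close>
  proof (rule right_ops.bounded_units[OF C _ F'(1)])
    show "\<exists>M P G N. right_ops.slice_bounds C N M P G \<and>
        (\<forall>f. complex_linear f \<longrightarrow> cmod (G (f o\<^sub>L blinfun_mult_right a) - f a) \<le> e * norm f)"
      if "0 < e" for a :: 'a and e using slices[OF that, of a] slice_bounds_opposite by blast
  qed (use F' in simp_all)
  then obtain B' where B': "0 < B'"
    and right: "\<And>(a::'a) e. 0 < e \<Longrightarrow> \<exists>r. norm r \<le> B' \<and> norm (blinfun_mult_left r a - a) < e" by blast
  show ?thesis
  proof (rule has_bounded_ai_one_sided[OF B B'])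
    show "\<exists>l::'a. norm l \<le> B \<and> (\<forall>a\<in>S. norm (l * a - a) < e)" if "finite S" "0 < e" for S e
      using left_ops.bounded_approximate_units[OF B left F(1) _ that] F(2)
      by (simp add: blinfun_mult_right.rep_eq)
    show "\<exists>r::'a. norm r \<le> B' \<and> (\<forall>a\<in>S. norm (a * r - a) < e)" if "finite S" "0 < e" for S e
      using right_ops.bounded_approximate_units[OF B' right F'(1) _ that] F'(2) by simp
  qed
qed

end
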